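(* Let $\mathcal{C}$ be an $[n,k]_{q^m/q}$ code. Let $m>n_1\geq \ldots\geq n_k\geq 1$ be positive integers. Then the following are equivalent: 1) $\mathcal{C}$ is equivalent to a code $\mathcal{C}'=\bigoplus_{i=1}^k\mathcal{C}_i$, where $\mathcal{C}_i$ is an MRD $[n_i,1]_{q^m/q}$ code, for every $i$; 2) $\mathcal{C}$ admits a basis $\{\mathbf{c}_1,\ldots,\mathbf{c}_k\}$ such that $n=\sum_{i=1}^k n_i$ and $\mathrm{supp}(\mathcal{C})=\bigoplus_{i=1}^k\mathrm{supp}(\mathbf{c}_i)$ (direct sum of $\mathbb{F}_q$-subspaces of $\mathbb{F}_q^n$), with $\dim_{\mathbb{F}_q}(\mathrm{supp}(\mathbf{c}_i))=n_i$, for every $i$; 3) $\mathcal{C}$ admits a basis $\{\mathbf{c}_1,\ldots,\mathbf{c}_k\}$ such that $n=\sum_{i=1}^k n_i$, with $n_i=\mathrm{w}(\mathbf{c}_i)$, for every $i$; 4) a generator matrix of a code equivalent to $\mathcal{C}$ is of the block-diagonal form $G=\mathbf{u}_1\oplus\mathbf{u}_2\oplus\ldots\oplus\mathbf{u}_k$, where $\mathbf{u}_i\in\mathbb{F}_{q^m}^{1\times n_i}$ and $\mathrm{w}(\mathbf{u}_i)=n_i$, for each $i$.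
   Context: Let $q$ be a prime power. The rank weight of $\mathbf{v}=(v_1,\ldots,v_n)\in\mathbb{F}_{q^m}^n$ is $\mathrm{w}(\mathbf{v})=\dim_{\mathbb{F}_q}\langle v_1,\ldots,v_n\rangle_{\mathbb{F}_q}$, and the rank distance is $d(\mathbf{u},\mathbf{v})=\mathrm{w}(\mathbf{u}-\mathbf{v})$. An $[n,k]_{q^m/q}$ code (or $[n,k,d]_{q^m/q}$ code) is a $k$-dimensional $\mathbb{F}_{q^m}$-subspace of $\mathbb{F}_{q^m}^n$ endowed with the rank distance (with minimum rank distance $d$ between distinct codewords); a basis of a code is an $\mathbb{F}_{q^m}$-basis. An $[n,k,d]_{q^m/q}$ code is MRD (maximum rank distance) if $mk=\max\{m,n\}(\min\{n,m\}-d+1)$. A generator matrix of $\mathcal{C}$ is a matrix $G\in\mathbb{F}_{q^m}^{k\times n}$ with $\mathcal{C}=\{\mathbf{x}G:\mathbf{x}\in\mathbb{F}_{q^m}^k\}$. For an ordered $\mathbb{F}_q$-basis $\Gamma=(\gamma_1,\ldots,\gamma_m)$ of $\mathbb{F}_{q^m}$ and $\mathbf{v}\in\mathbb{F}_{q^m}^n$, let $\Gamma(\mathbf{v})\in\mathbb{F}_q^{n\times m}$ be the matrix with $v_i=\sum_{j=1}^m\Gamma(\mathbf{v})_{ij}\gamma_j$ for all $i$; the support $\mathrm{supp}(\mathbf{v})\subseteq\mathbb{F}_q^n$ is the column span of $\Gamma(\mathbf{v})$ (independent of $\Gamma$). The support of a code is $\mathrm{supp}(\mathcal{C})=\mathrm{supp}(\mathbf{c}_1)+\ldots+\mathrm{supp}(\mathbf{c}_k)$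 (sum of vector spaces), where $\{\mathbf{c}_1,\ldots,\mathbf{c}_k\}$ is a basis of $\mathcal{C}$ (independent of the basis). Two codes $\mathcal{C},\mathcal{C}'\subseteq\mathbb{F}_{q^m}^n$ are equivalent if $\mathcal{C}'=\{\mathbf{c}A:\mathbf{c}\in\mathcal{C}\}$ for some $A\in\mathrm{GL}(n,q)$. The (external) direct sum of codes $\mathcal{C}_i\subseteq\mathbb{F}_{q^m}^{n_i}$, $i=1,\ldots,k$, is $\bigoplus_{i=1}^k\mathcal{C}_i=\{(\mathbf{c}_1,\ldots,\mathbf{c}_k):\mathbf{c}_i\in\mathcal{C}_i\}\subseteq\mathbb{F}_{q^m}^{n_1+\ldots+n_k}$. The direct sum $A_1\oplus\ldots\oplus A_\ell$ of matrices is the block-diagonal matrix with diagonal blocks $A_1,\ldots,A_\ell$ and zeros elsewhere.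
   Formalization: Condition 3) is shown to imply 1), 2) and 4) only for nondegenerate codes, supp(C) = F_q^n; without this it fails, e.g. for C spanned by (1,a,0,0),(a,1,0,0) with a not in F_q, n_1=n_2=2, m≥3. All other implications hold for every code. *)

theory Defs
  imports "Jordan_Normal_Form.VS_Connect" "HOL-Library.Cardinality"
begin

text \<open>
  The extension \<open>F\<^sub>q \<subseteq> F\<^bsub>q^m\<^esub>\<close> is given by a field homomorphism \<open>\<iota> :: 'f \<Rightarrow> 'e\<close> between
  finite field types with \<open>CARD('f) = q\<close> and \<open>CARD('e) = q ^ m\<close>. Vectors and matrices
  are those of \<open>Jordan_Normal_Form\<close> and are indexed from \<open>0\<close>.
\<close>

definition ext_scale :: "('f \<Rightarrow> 'e) \<Rightarrow> 'f \<Rightarrow> 'e \<Rightarrow> 'e::times" where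
  "ext_scale \<iota> a x = \<iota> a * x"

definition ordered_basis ::
    "('f::field \<Rightarrow> 'e::field) \<Rightarrow> nat \<Rightarrow> 'e list \<Rightarrow> bool" where
  "ordered_basis \<iota> m \<Gamma> \<longleftrightarrow> length \<Gamma> = m \<and> distinct \<Gamma> \<and>
     \<not> Modules.module.dependent (ext_scale \<iota>) (set \<Gamma>) \<and>
     Modules.module.span (ext_scale \<iota>) (set \<Gamma>) = UNIV"

definition rank_weight :: "('f::field \<Rightarrow> 'e::field) \<Rightarrow> 'e vec \<Rightarrow> nat" where
  "rank_weight \<iota> v =
     Vector_Spaces.vector_space.dim (ext_scale \<iota>)
       (Modules.module.span (ext_scale \<iota>) {v $ i | i. i < dim_vec v})"

definition rank_dist :: "('f::field \<Rightarrow> 'e::field) \<Rightarrow> 'e vec \<Rightarrow> 'e vec \<Rightarrow> nat" where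
  "rank_dist \<iota> u v = rank_weight \<iota> (u - v)"

definition is_subspace :: "nat \<Rightarrow> 'a::field vec set \<Rightarrow> bool" where
  "is_subspace n W \<longleftrightarrow> VectorSpace.subspace class_ring W (module_vec TYPE('a) n)"

definition subspace_dim :: "nat \<Rightarrow> 'a::field vec set \<Rightarrow> nat" where
  "subspace_dim n W = vectorspace.dim class_ring (module_vec TYPE('a) n\<lparr>carrier := W\<rparr>)"

definition is_code :: "nat \<Rightarrow> nat \<Rightarrow> 'e::field vec set \<Rightarrow> bool" where
  "is_code n k C \<longleftrightarrow> is_subspace n C \<and> subspace_dim n C = k"

definition code_basis :: "nat \<Rightarrow> 'e::field vec set \<Rightarrow> 'e vec list \<Rightarrow> bool" where
  "code_basis n C cs \<longleftrightarrow> distinct cs \<and>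
     vectorspace.basis class_ring (module_vec TYPE('e) n\<lparr>carrier := C\<rparr>) (set cs)"

definition min_dist :: "('f::field \<Rightarrow> 'e::field) \<Rightarrow> 'e vec set \<Rightarrow> nat" where
  "min_dist \<iota> C = Min {rank_dist \<iota> u v | u v. u \<in> C \<and> v \<in> C \<and> u \<noteq> v}"

text \<open>The equation is over \<open>int\<close> to avoid truncated subtraction.\<close>

definition is_mrd ::
    "('f::field \<Rightarrow> 'e::field) \<Rightarrow> nat \<Rightarrow> nat \<Rightarrow> nat \<Rightarrow> 'e vec set \<Rightarrow> bool" where
  "is_mrd \<iota> m n k C \<longleftrightarrow> is_code n k C \<and>
     int (m * k) = int (max m n) * (int (min n m) - int (min_dist \<iota> C) + 1)"

definition vec_mat_mult :: "'a::comm_semiring_0 vec \<Rightarrow> 'a mat \<Rightarrow> 'a vec" where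
  "vec_mat_mult x A = vec (dim_col A) (\<lambda>j. x \<bullet> col A j)"

definition generator_matrix :: "nat \<Rightarrow> nat \<Rightarrow> 'e::field mat \<Rightarrow> 'e vec set \<Rightarrow> bool" where
  "generator_matrix k n G C \<longleftrightarrow> G \<in> carrier_mat k n \<and>
     C = {vec_mat_mult x G | x. x \<in> carrier_vec k}"

definition code_equiv ::
    "('f::field \<Rightarrow> 'e::field) \<Rightarrow> nat \<Rightarrow> 'e vec set \<Rightarrow> 'e vec set \<Rightarrow> bool" where
  "code_equiv \<iota> n C C' \<longleftrightarrow> C \<subseteq> carrier_vec n \<and> C' \<subseteq> carrier_vec n \<and>
     (\<exists>A. A \<in> carrier_mat n n \<and> invertible_mat A \<and>
          C' = {vec_mat_mult c (map_mat \<iota> A) | c. c \<in> C})"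

definition ext_direct_sum :: "'e::field vec set list \<Rightarrow> 'e vec set" where
  "ext_direct_sum Cs = (\<lambda>cs. foldr (@\<^sub>v) cs vNil) ` listset Cs"

text \<open>\<open>coord_mat \<iota> \<Gamma> v\<close> is the matrix \<open>\<Gamma>(v)\<close>; it is unique when \<open>\<Gamma>\<close> is a basis.\<close>

definition coord_mat :: "('f::field \<Rightarrow> 'e::field) \<Rightarrow> 'e list \<Rightarrow> 'e vec \<Rightarrow> 'f mat" where
  "coord_mat \<iota> \<Gamma> v = (THE M. M \<in> carrier_mat (dim_vec v) (length \<Gamma>) \<and>
     (\<forall>i<dim_vec v. v $ i = (\<Sum>j<length \<Gamma>. \<iota> (M $$ (i, j)) * \<Gamma> ! j)))"

definition supp_vec :: "('f::field \<Rightarrow> 'e::field) \<Rightarrow> 'e list \<Rightarrow> 'e vec \<Rightarrow> 'f vec set" where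
  "supp_vec \<iota> \<Gamma> v = vec_space.col_space (dim_vec v) (coord_mat \<iota> \<Gamma> v)"

definition subspace_sum :: "nat \<Rightarrow> 'a::field vec set list \<Rightarrow> 'a vec set" where
  "subspace_sum n Ws =
     {finsum_vec TYPE('a) n w {..<length Ws} | w. \<forall>i<length Ws. w i \<in> Ws ! i}"

definition is_direct_sum :: "nat \<Rightarrow> 'a::field vec set \<Rightarrow> 'a vec set list \<Rightarrow> bool" where
  "is_direct_sum n S Ws \<longleftrightarrow> S = subspace_sum n Ws \<and>
     (\<forall>w. (\<forall>i<length Ws. w i \<in> Ws ! i) \<and> finsum_vec TYPE('a) n w {..<length Ws} = 0\<^sub>v n
        \<longrightarrow> (\<forall>i<length Ws. w i = 0\<^sub>v n))"

text \<open>The sum of the supports does not depend on the basis of \<open>C\<close>, so any basis may be chosen.\<close>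

definition supp_code ::
    "('f::field \<Rightarrow> 'e::field) \<Rightarrow> 'e list \<Rightarrow> nat \<Rightarrow> 'e vec set \<Rightarrow> 'f vec set" where
  "supp_code \<iota> \<Gamma> n C = subspace_sum n (map (supp_vec \<iota> \<Gamma>) (SOME cs. code_basis n C cs))"

text \<open>
  Nondegeneracy is what makes the condition on weights below imply the others: the length-4
  code spanned by \<open>(1, a, 0, 0)\<close> and \<open>(a, 1, 0, 0)\<close>, with \<open>a\<close> of degree at least 3 over \<open>F\<^sub>q\<close>,
  has a basis of two vectors of weight 2, but its support has dimension 2 instead of 4.
\<close>

definition nondegenerate ::
    "('f::field \<Rightarrow> 'e::field) \<Rightarrow> 'e list \<Rightarrow> nat \<Rightarrow> 'e vec set \<Rightarrow> bool" where
  "nondegenerate \<iota> \<Gamma> n C \<longleftrightarrow> supp_code \<iota> \<Gamma> n C = carrier_vec n"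

text \<open>
  The four conditions; \<open>ns\<close> is the list \<open>n\<^sub>1, \<dots>, n\<^sub>k\<close>. In the first and the last one,
  \<open>n = n\<^sub>1 + \<dots> + n\<^sub>k\<close> is forced, since \<open>code_equiv\<close> relates codes of the same length.
\<close>

definition equivalent_to_sum_of_mrd ::
    "('f::field \<Rightarrow> 'e::field) \<Rightarrow> nat \<Rightarrow> nat \<Rightarrow> nat \<Rightarrow> nat list \<Rightarrow> 'e vec set \<Rightarrow> bool" where
  "equivalent_to_sum_of_mrd \<iota> m n k ns C \<longleftrightarrow>
     (\<exists>Cs. length Cs = k \<and> (\<forall>i<k. is_mrd \<iota> m (ns ! i) 1 (Cs ! i)) \<and>
           code_equiv \<iota> n C (ext_direct_sum Cs))"

definition has_basis_splitting_support ::
    "('f::field \<Rightarrow> 'e::field) \<Rightarrow> 'e list \<Rightarrow> nat \<Rightarrow> nat \<Rightarrow> nat list \<Rightarrow> 'e vec set \<Rightarrow> bool" where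
  "has_basis_splitting_support \<iota> \<Gamma> n k ns C \<longleftrightarrow>
     (\<exists>cs. length cs = k \<and> code_basis n C cs \<and> n = sum_list ns \<and>
           is_direct_sum n (supp_code \<iota> \<Gamma> n C) (map (supp_vec \<iota> \<Gamma>) cs) \<and>
           (\<forall>i<k. subspace_dim n (supp_vec \<iota> \<Gamma> (cs ! i)) = ns ! i))"

definition has_basis_of_weights ::
    "('f::field \<Rightarrow> 'e::field) \<Rightarrow> nat \<Rightarrow> nat \<Rightarrow> nat list \<Rightarrow> 'e vec set \<Rightarrow> bool" where
  "has_basis_of_weights \<iota> n k ns C \<longleftrightarrow>
     (\<exists>cs. length cs = k \<and> code_basis n C cs \<and> n = sum_list ns \<and>
           (\<forall>i<k. ns ! i = rank_weight \<iota> (cs ! i)))"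

definition has_block_diag_generator ::
    "('f::field \<Rightarrow> 'e::field) \<Rightarrow> nat \<Rightarrow> nat \<Rightarrow> nat list \<Rightarrow> 'e vec set \<Rightarrow> bool" where
  "has_block_diag_generator \<iota> n k ns C \<longleftrightarrow>
     (\<exists>C' G us. code_equiv \<iota> n C C' \<and> generator_matrix k n G C' \<and>
           length us = k \<and> G = diag_block_mat us \<and>
           (\<forall>i<k. us ! i \<in> carrier_mat 1 (ns ! i) \<and> rank_weight \<iota> (row (us ! i) 0) = ns ! i))"

end

theory Submission
  imports Defs
begin

text \<open>
  The support of \<open>v\<close> is the set of all vectors \<open>\<phi>(v)\<close> obtained by applying an \<open>F\<^sub>q\<close>-linear
  functional \<open>\<phi>\<close> of \<open>F\<^bsub>q^m\<^esub>\<close> to every entry of \<open>v\<close>. A functional is determined on the span of the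
  entries by its values on a basis, so the support has \<open>q^w(v)\<close> elements, and for a matrix \<open>A\<close>
  over \<open>F\<^sub>q\<close> the support of \<open>vA\<close> is the image under \<open>A\<close> of the support of \<open>v\<close>. Since everything
  is finite, a sum of supports is direct if and only if it has as many elements as the product of
  the summands; for a basis whose weights add up to \<open>n\<close> this says that the code is
  nondegenerate, so the splitting of the support means nondegeneracy together with the weights.

  A block-diagonal generator with blocks of full weight has full support and rows of the right
  weights. Conversely, write each basis vector as \<open>c\<^sub>i = u\<^sub>i A\<^sub>i\<close>, where the entries of \<open>u\<^sub>i\<close> are a
  basis of the span of the entries of \<open>c\<^sub>i\<close>, and stack the matrices \<open>A\<^sub>i\<close> over \<open>F\<^sub>q\<close>: the row space
  of the resulting \<open>n \<times> n\<close> matrix contains the support of the code, so it is invertible when the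
  code is nondegenerate. Finally, for \<open>n\<^sub>i < m\<close> a one-dimensional code is MRD exactly when it is
  generated by a vector of weight \<open>n\<^sub>i\<close>, because weights are invariant under scalars.
\<close>

section \<open>Row vectors, generator matrices and bases\<close>

lemma dim_vec_mat_mult [simp]: "dim_vec (vec_mat_mult x A) = dim_col A"
  by (simp add: vec_mat_mult_def)

lemma vec_mat_mult_closed [simp, intro]:
  "A \<in> carrier_mat k n \<Longrightarrow> vec_mat_mult x A \<in> carrier_vec n"
  by (simp add: vec_mat_mult_def)

lemma vec_mat_mult_index:
  "A \<in> carrier_mat k n \<Longrightarrow> j < n \<Longrightarrow> vec_mat_mult x A $ j = (\<Sum>i<k. x $ i * A $$ (i, j))"
  by (simp add: vec_mat_mult_def scalar_prod_def lessThan_atLeast0)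

lemma vec_mat_mult_conv_transpose:
  assumes "A \<in> carrier_mat k n" "x \<in> carrier_vec k"
  shows "vec_mat_mult x A = A\<^sup>T *\<^sub>v x"
  using assms by (intro eq_vecI) (simp_all add: vec_mat_mult_def comm_scalar_prod[of x k])

lemma vec_mat_mult_assoc:
  assumes "A \<in> carrier_mat k l" "B \<in> carrier_mat l n" "x \<in> carrier_vec k"
  shows "vec_mat_mult (vec_mat_mult x A) B = vec_mat_mult x (A * B)"
proof -
  have "(A * B)\<^sup>T *\<^sub>v x = B\<^sup>T *\<^sub>v (A\<^sup>T *\<^sub>v x)"
    using assms by (simp add: transpose_mult)
  moreover have "vec_mat_mult (vec_mat_mult x A) B = B\<^sup>T *\<^sub>v vec_mat_mult x A"
    using assms by (intro vec_mat_mult_conv_transpose) auto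
  ultimately show ?thesis
    using assms by (simp add: vec_mat_mult_conv_transpose[of _ k l] vec_mat_mult_conv_transpose[of _ k n])
qed

lemma vec_mat_mult_one: "(x :: 'a::comm_semiring_1 vec) \<in> carrier_vec n \<Longrightarrow> vec_mat_mult x (1\<^sub>m n) = x"
  by (simp add: vec_mat_mult_conv_transpose[of _ n n])

lemma vec_mat_mult_unit:
  assumes "(A :: 'a::comm_semiring_1 mat) \<in> carrier_mat k n" "i < k"
  shows "vec_mat_mult (unit_vec k i) A = row A i"
  using assms by (intro eq_vecI) (simp_all add: vec_mat_mult_def)

lemma row_mult_mat:
  assumes "A \<in> carrier_mat k l" "B \<in> carrier_mat l n" "i < k"
  shows "row (A * B) i = vec_mat_mult (row A i) B"
  using assms by (intro eq_vecI) (simp_all add: vec_mat_mult_def)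

text \<open>Unpacks \<open>invertible_mat\<close> into an inverse of known size, so that the carrier
  rules for products apply afterwards.\<close>

lemma invertible_matE:
  assumes "invertible_mat A" "A \<in> carrier_mat n n"
  obtains B where "B \<in> carrier_mat n n" "A * B = 1\<^sub>m n" "B * A = 1\<^sub>m n"
proof -
  obtain B where "A * B = 1\<^sub>m (dim_row A)" "B * A = 1\<^sub>m (dim_row B)"
    using assms(1) by (auto simp: invertible_mat_def inverts_mat_def)
  \<comment> \<open>\<open>invertible_mat\<close> does not record the size of \<open>B\<close>;
    comparing the dimensions of both sides of the two identities recovers it.\<close>
  moreover from this have "dim_col B = n" "dim_row B = n"
    using assms(2) by (metis carrier_matD index_mult_mat(2,3) index_one_mat(2,3))+
  ultimately show thesis
    using that[of B] assms(2) by auto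
qed

lemma invertible_matI:
  "A \<in> carrier_mat n n \<Longrightarrow> B \<in> carrier_mat n n \<Longrightarrow> A * B = 1\<^sub>m n \<Longrightarrow> B * A = 1\<^sub>m n \<Longrightarrow> invertible_mat A"
  by (auto simp: invertible_mat_def inverts_mat_def)

text \<open>Preimages of the unit vectors, taken as rows, form a left inverse, and for square
  matrices over a field a left inverse is two-sided.\<close>

lemma invertible_mat_if_surj:
  fixes A :: "'a::field mat"
  assumes A: "A \<in> carrier_mat n n"
    and surj: "\<And>y. y \<in> carrier_vec n \<Longrightarrow> \<exists>x\<in>carrier_vec n. y = vec_mat_mult x A"
  obtains B where "B \<in> carrier_mat n n" "A * B = 1\<^sub>m n" "B * A = 1\<^sub>m n"
proof -
  obtain x where x: "x i \<in> carrier_vec n" "unit_vec n i = vec_mat_mult (x i) A" for i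
    using surj[OF unit_vec_carrier] by metis
  define B where "B = mat_of_rows n (map x [0..<n])"
  have B: "B \<in> carrier_mat n n"
    by (simp add: B_def carrier_matI)
  have "B * A = 1\<^sub>m n"
  proof (rule eq_rowI)
    fix i assume "i < dim_row (1\<^sub>m n :: 'a mat)"
    then show "row (B * A) i = row (1\<^sub>m n) i"
      using x A by (subst row_mult_mat[OF B A]) (simp_all add: B_def)
  qed (use A B in auto)
  then show thesis
    using that A B mat_mult_left_right_inverse by blast
qed

lemma generator_matrix_mult:
  assumes "generator_matrix k n G C" "A \<in> carrier_mat n n'"
  shows "generator_matrix k n' (G * A) {vec_mat_mult c A | c. c \<in> C}"
proof -
  have G: "G \<in> carrier_mat k n" and C: "C = {vec_mat_mult x G | x. x \<in> carrier_vec k}"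
    using assms(1) by (simp_all add: generator_matrix_def)
  have "{vec_mat_mult c A | c. c \<in> C} = (\<lambda>x. vec_mat_mult (vec_mat_mult x G) A) ` carrier_vec k"
    unfolding C by auto
  also have "\<dots> = (\<lambda>x. vec_mat_mult x (G * A)) ` carrier_vec k"
    by (rule image_cong[OF refl], rule vec_mat_mult_assoc[OF G assms(2)])
  finally show ?thesis
    unfolding generator_matrix_def using mult_carrier_mat[OF G assms(2)] by blast
qed

lemma generator_matrix_row:
  assumes "generator_matrix k n G C" "i < k"
  shows "row G i \<in> C"
proof -
  have "row G i = vec_mat_mult (unit_vec k i) G"
    using assms by (simp add: generator_matrix_def vec_mat_mult_unit[of _ k n])
  then show ?thesis
    using assms(1) unit_vec_carrier unfolding generator_matrix_def by blast
qed

text \<open>Each row of \<open>G\<close> is a codeword, hence a combination of the rows of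
  \<open>H\<close>; the coefficient vectors are the rows of \<open>P\<close>. This is what makes the
  sum of the supports of the rows independent of the generator matrix.\<close>

lemma generator_matrix_factor:
  assumes G: "generator_matrix k n G C" and H: "generator_matrix l n H C"
  obtains P where "P \<in> carrier_mat k l" "G = P * H"
proof -
  have "\<exists>x. x \<in> carrier_vec l \<and> row G i = vec_mat_mult x H" if "i < k" for i
    using generator_matrix_row[OF G that] H by (auto simp: generator_matrix_def)
  then obtain x where x: "x i \<in> carrier_vec l" "row G i = vec_mat_mult (x i) H" if "i < k" for i
    by metis
  have GH: "G \<in> carrier_mat k n" "H \<in> carrier_mat l n"
    using G H by (auto simp: generator_matrix_def)
  define P where "P = mat_of_rows l (map x [0..<k])"
  have P: "P \<in> carrier_mat k l"
    by (simp add: P_def carrier_matI)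
  have "G = P * H"
  proof (rule eq_rowI)
    fix i assume "i < dim_row (P * H)"
    then show "row G i = row (P * H) i"
      using x P by (subst row_mult_mat[OF P GH(2)]) (simp_all add: P_def)
  qed (use P GH in auto)
  with P show thesis by (rule that)
qed

section \<open>Counting in subspaces over a finite field\<close>

lemma finite_carrier_vec [simp]: "finite (carrier_vec n :: 'a::finite vec set)"
proof -
  have "carrier_vec n \<subseteq> vec_of_list ` {xs :: 'a list. set xs \<subseteq> UNIV \<and> length xs = n}"
  proof
    fix v :: "'a vec" assume "v \<in> carrier_vec n"
    then show "v \<in> vec_of_list ` {xs. set xs \<subseteq> UNIV \<and> length xs = n}"
      by (intro image_eqI[of _ _ "list_of_vec v"]) (auto simp: vec_list)
  qed
  then show ?thesis
    by (rule finite_subset) (intro finite_imageI finite_lists_length_eq finite)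
qed

text \<open>A finite carrier generates the space, so a finite basis exists, and taking linear
  combinations is a bijection from the coordinate functions to the carrier. Extensional functions
  make the coordinates unique off the basis as well.\<close>

lemma (in vectorspace) card_carrier:
  assumes "finite (carrier V)"
  shows "card (carrier V) = card (carrier K) ^ dim"
proof -
  have gen: "gen_set (carrier V)"
    using in_own_span[of "carrier V"] span_is_subset2[of "carrier V"] by auto
  then have "fin_dim"
    using assms unfolding fin_dim_def by blast
  then obtain \<beta> where \<beta>: "finite \<beta>" "basis \<beta>"
    using finite_basis_exists by blast
  then have \<beta>V: "\<beta> \<subseteq> carrier V"
    by (simp add: basis_def)
  have unique: "\<exists>!a. a \<in> \<beta> \<rightarrow>\<^sub>E carrier K \<and> lincomb a \<beta> = v" if "v \<in> carrier V" for v
    using basis_criterion[OF \<beta>(1) \<beta>V] \<beta>(2) that by blast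
  have "bij_betw (\<lambda>a. lincomb a \<beta>) (\<beta> \<rightarrow>\<^sub>E carrier K) (carrier V)"
  proof (rule bij_betwI')
    fix a b assume a: "a \<in> \<beta> \<rightarrow>\<^sub>E carrier K" and b: "b \<in> \<beta> \<rightarrow>\<^sub>E carrier K"
    then have "lincomb a \<beta> \<in> carrier V"
      using \<beta>V by (intro lincomb_closed) auto
    then show "lincomb a \<beta> = lincomb b \<beta> \<longleftrightarrow> a = b"
      using unique a b by metis
  next
    fix a assume "a \<in> \<beta> \<rightarrow>\<^sub>E carrier K"
    then show "lincomb a \<beta> \<in> carrier V"
      using \<beta>V by (intro lincomb_closed) auto
  next
    fix v assume "v \<in> carrier V"
    then show "\<exists>a\<in>\<beta> \<rightarrow>\<^sub>E carrier K. v = lincomb a \<beta>"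
      using unique by metis
  qed
  from bij_betw_same_card[OF this] show ?thesis
    by (simp add: card_PiE[OF \<beta>(1)] dim_basis[OF \<beta>])
qed

lemma is_subspace_vectorspace:
  assumes "is_subspace n (W :: 'a::field vec set)"
  shows "vectorspace class_ring (module_vec TYPE('a) n\<lparr>carrier := W\<rparr>)"
  by (rule vectorspace.subspace_is_vs[OF vec_vs assms[unfolded is_subspace_def]])

lemma subspace_carrier:
  assumes "is_subspace n W"
  shows "W \<subseteq> carrier_vec n"
  using submodule.subset[OF subspace.submod[OF assms[unfolded is_subspace_def]]]
  by (simp add: module_vec_simps)

lemma card_subspace:
  fixes W :: "'a::{field,finite} vec set"
  assumes "is_subspace n W"
  shows "card W = CARD('a) ^ subspace_dim n W"
proof -
  interpret W: vectorspace class_ring "module_vec TYPE('a) n\<lparr>carrier := W\<rparr>"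
    using is_subspace_vectorspace[OF assms] .
  have "finite W"
    using subspace_carrier[OF assms] by (rule finite_subset) simp
  then show ?thesis
    using W.card_carrier by (simp add: subspace_dim_def class_ring_simps)
qed

section \<open>Bases of a code as generator matrices\<close>

lemma span_set_eq_vec_mat_mult:
  fixes cs :: "'a::field vec list"
  assumes "set cs \<subseteq> carrier_vec n"
  shows "LinearCombinations.module.span class_ring (module_vec TYPE('a) n) (set cs) =
    {vec_mat_mult x (mat_of_rows n cs) | x. x \<in> carrier_vec (length cs)}"
proof -
  interpret vec_space "TYPE('a)" n .
  have cs: "mat_of_cols n cs \<in> carrier_mat n (length cs)"
    by simp
  have "span (set cs) = {mat_of_cols n cs *\<^sub>v x | x. x \<in> carrier_vec (length cs)}"
    using col_space_eq[OF cs] cols_mat_of_cols[OF assms] mult_mat_vec_carrier[OF cs]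
    by (auto simp: col_space_def)
  also have "\<dots> = {vec_mat_mult x (mat_of_rows n cs) | x. x \<in> carrier_vec (length cs)}"
    unfolding setcompr_eq_image
    by (rule image_cong)
      (simp_all add: vec_mat_mult_conv_transpose[of _ "length cs" n] transpose_mat_of_rows)
  finally show ?thesis .
qed

lemma is_subspace_of_generator_matrix:
  assumes "generator_matrix k n G C"
  shows "is_subspace n C"
proof -
  have G: "G \<in> carrier_mat k n"
    using assms by (simp add: generator_matrix_def)
  have "C = LinearCombinations.module.span class_ring (module_vec TYPE('a) n) (set (rows G))"
    using assms rows_carrier[of G] mat_of_rows_rows[of G] G
    by (simp add: span_set_eq_vec_mat_mult generator_matrix_def)
  moreover have "set (rows G) \<subseteq> carrier (module_vec TYPE('a) n)"
    using rows_carrier[of G] G by (simp add: module_vec_simps)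
  ultimately show ?thesis
    unfolding is_subspace_def by (metis vec_vs vectorspace.span_is_subspace)
qed

text \<open>In dimension \<open>k\<close>, a generating list of length \<open>k\<close> is
  automatically distinct and independent, so being a basis reduces to generating. Everything later
  argues with matrices instead of bases.\<close>

lemma code_basis_iff_generator_matrix:
  assumes C: "is_code n k C" and len: "length cs = k"
  shows "code_basis n C cs \<longleftrightarrow> set cs \<subseteq> carrier_vec n \<and> generator_matrix k n (mat_of_rows n cs) C"
proof -
  let ?V = "module_vec TYPE('a) n"
  interpret V: vectorspace class_ring ?V
    by (rule vec_vs)
  have sub: "is_subspace n C" and dim: "subspace_dim n C = k"
    using C by (auto simp: is_code_def)
  have CV: "C \<subseteq> carrier_vec n"
    using sub by (rule subspace_carrier)
  interpret W: vectorspace class_ring "?V\<lparr>carrier := C\<rparr>"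
    using is_subspace_vectorspace[OF sub] .
  have submod: "submodule class_ring C ?V"
    using sub by (simp add: is_subspace_def subspace_def)
  \<comment> \<open>Since \<open>C\<close> is a submodule, the span formed inside \<open>C\<close>
    agrees with the span formed in the whole space.\<close>
  have gen: "W.gen_set (set cs) \<longleftrightarrow> generator_matrix k n (mat_of_rows n cs) C" if "set cs \<subseteq> C"
    using V.span_li_not_depend(1)[OF that submod] span_set_eq_vec_mat_mult[of cs n] that CV len
    by (auto simp: generator_matrix_def carrier_matI)
  show ?thesis
  proof
    assume "code_basis n C cs"
    then have "set cs \<subseteq> C" "W.gen_set (set cs)"
      by (auto simp: code_basis_def W.basis_def)
    then show "set cs \<subseteq> carrier_vec n \<and> generator_matrix k n (mat_of_rows n cs) C"
      using gen CV by blast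
  next
    assume *: "set cs \<subseteq> carrier_vec n \<and> generator_matrix k n (mat_of_rows n cs) C"
    have "set cs \<subseteq> C"
    proof
      fix c assume "c \<in> set cs"
      then obtain i where "i < k" "c = cs ! i"
        using len by (auto simp: in_set_conv_nth)
      then show "c \<in> C"
        using generator_matrix_row[OF conjunct2[OF *], of i] * len by (simp add: subset_iff)
    qed
    then have gs: "W.gen_set (set cs)" "set cs \<subseteq> carrier (?V\<lparr>carrier := C\<rparr>)"
      using gen * by auto
    have fd: "W.fin_dim"
      unfolding W.fin_dim_def using gs finite_set by blast
    have Wdim: "W.dim = k"
      using dim by (simp add: subspace_dim_def)
    have "W.dim \<le> card (set cs)"
      using gs by (intro W.gen_ge_dim) auto
    then have "distinct cs"
      using Wdim len card_length[of cs] by (intro card_distinct) simp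
    moreover have "W.basis (set cs)"
      using gs fd Wdim len card_length[of cs] by (intro W.dim_gen_is_basis) auto
    ultimately show "code_basis n C cs"
      by (simp add: code_basis_def)
  qed
qed

text \<open>Guarantees that the choice made in \<open>supp_code\<close> really yields a
  basis.\<close>

lemma code_basis_exists:
  assumes "is_code n k (C :: 'a::{field,finite} vec set)"
  shows "\<exists>cs. length cs = k \<and> code_basis n C cs"
proof -
  let ?V = "module_vec TYPE('a) n"
  have sub: "is_subspace n C" and dim: "subspace_dim n C = k"
    using assms by (auto simp: is_code_def)
  interpret W: vectorspace class_ring "?V\<lparr>carrier := C\<rparr>"
    using is_subspace_vectorspace[OF sub] .
  have "finite C"
    using subspace_carrier[OF sub] by (rule finite_subset) simp
  then have "W.fin_dim"
    unfolding W.fin_dim_def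
    using W.in_own_span[of C] W.span_is_subset2[of C] by (intro exI[of _ C]) auto
  then obtain \<beta> where \<beta>: "finite \<beta>" "W.basis \<beta>"
    using W.finite_basis_exists by blast
  obtain cs where "set cs = \<beta>" "distinct cs"
    using finite_distinct_list[OF \<beta>(1)] by blast
  then show ?thesis
    using \<beta> W.dim_basis[OF \<beta>] dim distinct_card[of cs]
    by (auto simp: code_basis_def subspace_dim_def intro!: exI[of _ cs])
qed

lemma code_basis_length:
  assumes "is_code n k C" "code_basis n C cs"
  shows "length cs = k"
proof -
  have sub: "is_subspace n C" and dim: "subspace_dim n C = k"
    using assms by (auto simp: is_code_def)
  interpret W: vectorspace class_ring "module_vec TYPE('a) n\<lparr>carrier := C\<rparr>"
    using is_subspace_vectorspace[OF sub] .
  have "W.basis (set cs)" "distinct cs"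
    using assms(2) by (auto simp: code_basis_def)
  then show ?thesis
    using W.dim_basis[of "set cs"] dim by (simp add: subspace_dim_def distinct_card)
qed

lemma card_carrier_vec: "card (carrier_vec n :: 'a::{field,finite} vec set) = CARD('a) ^ n"
proof -
  interpret vec_space "TYPE('a)" n .
  show ?thesis
    using vectorspace.card_carrier[OF vec_vs[where n = n and ?'a = 'a]] dim_is_n
    by (simp add: class_ring_simps module_vec_simps)
qed

section \<open>External direct sums and block-diagonal matrices\<close>

lemma ext_direct_sum_Cons:
  "ext_direct_sum (C # Cs) = {c @\<^sub>v d | c d. c \<in> C \<and> d \<in> ext_direct_sum Cs}"
proof (intro equalityI subsetI)
  fix v assume "v \<in> ext_direct_sum (C # Cs)"
  then obtain c cs where "v = c @\<^sub>v foldr (@\<^sub>v) cs vNil" "c \<in> C" "cs \<in> listset Cs"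
    by (auto simp: ext_direct_sum_def set_Cons_def)
  then show "v \<in> {c @\<^sub>v d | c d. c \<in> C \<and> d \<in> ext_direct_sum Cs}"
    unfolding ext_direct_sum_def by blast
next
  fix v assume "v \<in> {c @\<^sub>v d | c d. c \<in> C \<and> d \<in> ext_direct_sum Cs}"
  then obtain c cs where "v = c @\<^sub>v foldr (@\<^sub>v) cs vNil" "c \<in> C" "cs \<in> listset Cs"
    by (auto simp: ext_direct_sum_def)
  then show "v \<in> ext_direct_sum (C # Cs)"
    by (auto simp: ext_direct_sum_def set_Cons_def intro!: image_eqI[of _ _ "c # cs"])
qed

lemma vec_mat_mult_four_block_mat:
  assumes A: "A \<in> carrier_mat k n" and D: "D \<in> carrier_mat l p"
    and x: "x \<in> carrier_vec k" and y: "y \<in> carrier_vec l"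
  shows "vec_mat_mult (x @\<^sub>v y) (four_block_mat A (0\<^sub>m k p) (0\<^sub>m l n) D) =
    vec_mat_mult x A @\<^sub>v vec_mat_mult y D"
proof (rule eq_vecI)
  let ?M = "four_block_mat A (0\<^sub>m k p) (0\<^sub>m l n) D"
  fix j assume "j < dim_vec (vec_mat_mult x A @\<^sub>v vec_mat_mult y D)"
  then have j: "j < n + p"
    using A D by simp
  have M: "?M \<in> carrier_mat (k + l) (n + p)"
    using A D by simp
  have "vec_mat_mult (x @\<^sub>v y) ?M $ j = (x @\<^sub>v y) \<bullet> col ?M j"
    using j A D by (simp add: vec_mat_mult_def)
  also have "\<dots> = (vec_mat_mult x A @\<^sub>v vec_mat_mult y D) $ j"
  proof (cases "j < n")
    case True
    then have "col ?M j = col A j @\<^sub>v 0\<^sub>v l"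
      using A D by (intro eq_vecI) auto
    then show ?thesis
      using True A D x y j by (simp add: scalar_prod_append[of _ k _ l] vec_mat_mult_def)
  next
    case False
    then have "col ?M j = 0\<^sub>v k @\<^sub>v col D (j - n)"
      using A D j by (intro eq_vecI) auto
    moreover have "col D (j - n) \<in> carrier_vec l" "j - n < p"
      using False D j by auto
    ultimately show ?thesis
      using False A D x y j by (simp add: scalar_prod_append[of _ k _ l] vec_mat_mult_def)
  qed
  finally show "vec_mat_mult (x @\<^sub>v y) ?M $ j = (vec_mat_mult x A @\<^sub>v vec_mat_mult y D) $ j" .
qed (use A D in simp)

text \<open>A coefficient vector for the block matrix splits at the block boundary into coefficient
  vectors for the blocks. Sizes are read off the matrices, so the induction carries no separate
  lists of lengths.\<close>

lemma generator_matrix_ext_direct_sum: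
  assumes "list_all2 (\<lambda>u C. generator_matrix (dim_row u) (dim_col u) u C) us Cs"
  shows "generator_matrix (dim_row (diag_block_mat us)) (dim_col (diag_block_mat us))
    (diag_block_mat us) (ext_direct_sum Cs)"
  using assms
proof (induction rule: list_all2_induct)
  case Nil
  have "vec_mat_mult x (0\<^sub>m 0 0) = vNil" for x :: "'a vec"
    by (rule eq_vecI) simp_all
  then show ?case
    by (auto simp: generator_matrix_def ext_direct_sum_def)
next
  case (Cons u us C Cs)
  define D where "D = diag_block_mat us"
  let ?k = "dim_row u" and ?n = "dim_col u" and ?l = "dim_row D" and ?p = "dim_col D"
  let ?M = "four_block_mat u (0\<^sub>m ?k ?p) (0\<^sub>m ?l ?n) D"
  have u: "u \<in> carrier_mat ?k ?n" and D: "D \<in> carrier_mat ?l ?p" by auto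
  have C: "C = {vec_mat_mult x u | x. x \<in> carrier_vec ?k}"
    and E: "ext_direct_sum Cs = {vec_mat_mult y D | y. y \<in> carrier_vec ?l}"
    using Cons by (simp_all add: generator_matrix_def D_def)
  have "ext_direct_sum (C # Cs) = {vec_mat_mult z ?M | z. z \<in> carrier_vec (?k + ?l)}"
  proof (intro equalityI subsetI)
    fix v assume "v \<in> ext_direct_sum (C # Cs)"
    then obtain x y where v: "v = vec_mat_mult x u @\<^sub>v vec_mat_mult y D"
        and xy: "x \<in> carrier_vec ?k" "y \<in> carrier_vec ?l"
      unfolding ext_direct_sum_Cons unfolding C E by blast
    have "v = vec_mat_mult (x @\<^sub>v y) ?M"
      using v vec_mat_mult_four_block_mat[OF u D xy] by simp
    then show "v \<in> {vec_mat_mult z ?M | z. z \<in> carrier_vec (?k + ?l)}"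
      using append_carrier_vec[OF xy] by blast
  next
    fix v assume "v \<in> {vec_mat_mult z ?M | z. z \<in> carrier_vec (?k + ?l)}"
    then obtain z where z: "v = vec_mat_mult z ?M" "z \<in> carrier_vec (?k + ?l)" by blast
    have "v = vec_mat_mult (vec_first z ?k) u @\<^sub>v vec_mat_mult (vec_last z ?l) D"
      using vec_mat_mult_four_block_mat[OF u D vec_first_carrier vec_last_carrier, of z z]
      unfolding z(1) vec_first_last_append[OF z(2)] .
    then show "v \<in> ext_direct_sum (C # Cs)"
      unfolding ext_direct_sum_Cons unfolding C E
      using vec_first_carrier vec_last_carrier by blast
  qed
  moreover have "diag_block_mat (u # us) = ?M"
    by (simp add: Let_def D_def)
  moreover have "?M \<in> carrier_mat (?k + ?l) (?n + ?p)"
    using u D by simp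
  ultimately show ?case
    unfolding generator_matrix_def by (simp only: carrier_matD)
qed

section \<open>Direct sums of subspaces by counting\<close>

lemma finsum_vec_lessThan:
  fixes w :: "nat \<Rightarrow> 'a::field vec"
  assumes "\<And>i. i < k \<Longrightarrow> w i \<in> carrier_vec n"
  shows "finsum_vec TYPE('a) n w {..<k} \<in> carrier_vec n"
    "j < n \<Longrightarrow> finsum_vec TYPE('a) n w {..<k} $ j = (\<Sum>i<k. w i $ j)"
  using assms by (auto intro!: finsum_vec_closed index_finsum_vec)

lemma is_subspace_zero: "is_subspace n W \<Longrightarrow> 0\<^sub>v n \<in> W"
  using submodule.zero_closed[OF subspace.submod] by (fastforce simp: is_subspace_def module_vec_simps)

lemma is_subspace_minus:
  fixes W :: "'a::field vec set"
  assumes W: "is_subspace n W" and xy: "x \<in> W" "y \<in> W"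
  shows "x - y \<in> W"
proof -
  have sub: "submodule class_ring W (module_vec TYPE('a) n)"
    using W by (simp add: is_subspace_def subspace.submod)
  have "x + (- 1) \<cdot>\<^sub>v y \<in> W"
    using submodule.m_closed[OF sub xy(1) submodule.smult_closed[OF sub _ xy(2), of "- 1"]]
    by (simp add: module_vec_simps class_ring_simps)
  moreover have "x + (- 1) \<cdot>\<^sub>v y = x - y"
    using subspace_carrier[OF W] xy by (intro eq_vecI) auto
  ultimately show ?thesis by simp
qed

text \<open>Summation maps the finite product of the subspaces onto their sum. Equality of the
  cardinalities therefore means injectivity, and for an additive map this means that only the zero
  family has sum zero.\<close>

lemma is_direct_sum_iff_card:
  fixes Ws :: "'a::{field,finite} vec set list"
  assumes sub: "\<And>W. W \<in> set Ws \<Longrightarrow> is_subspace n W"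
  shows "is_direct_sum n (subspace_sum n Ws) Ws \<longleftrightarrow>
    card (subspace_sum n Ws) = (\<Prod>i<length Ws. card (Ws ! i))"
proof -
  let ?k = "length Ws"
  define T where "T w = finsum_vec TYPE('a) n w {..<?k}" for w :: "nat \<Rightarrow> 'a vec"
  define P where "P = (\<Pi>\<^sub>E i\<in>{..<?k}. Ws ! i)"
  have sub': "is_subspace n (Ws ! i)" if "i < ?k" for i
    using sub that by simp
  have carr: "w i \<in> carrier_vec n" if "\<forall>i<?k. w i \<in> Ws ! i" "i < ?k" for w i
    using subspace_carrier[OF sub'[OF that(2)]] that by blast
  have T_carr: "T w \<in> carrier_vec n" if "\<forall>i<?k. w i \<in> Ws ! i" for w
    unfolding T_def by (rule finsum_vec_lessThan(1)[OF carr[OF that]])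
  have T_index: "T w $ j = (\<Sum>i<?k. w i $ j)" if "\<forall>i<?k. w i \<in> Ws ! i" "j < n" for w j
    unfolding T_def by (rule finsum_vec_lessThan(2)[OF carr[OF that(1)] that(2)])
  have PD: "\<forall>i<?k. w i \<in> Ws ! i" if "w \<in> P" for w
    using that by (auto simp: P_def)
  \<comment> \<open>The sum only sees indices below \<open>?k\<close>. Cutting families down to
    extensional ones makes their set \<open>P\<close> finite, as the comparison of cardinalities
    requires.\<close>
  have restrict: "restrict w {..<?k} \<in> P" "T (restrict w {..<?k}) = T w" if w: "\<forall>i<?k. w i \<in> Ws ! i" for w
  proof -
    show P: "restrict w {..<?k} \<in> P"
      using w by (auto simp: P_def)
    show "T (restrict w {..<?k}) = T w"
    proof (rule eq_vecI)
      fix j assume "j < dim_vec (T w)"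
      then have j: "j < n" using T_carr[OF w] by simp
      show "T (restrict w {..<?k}) $ j = T w $ j"
        unfolding T_index[OF w j] T_index[OF PD[OF P] j] by (intro sum.cong) auto
    qed (use carrier_vecD[OF T_carr[OF w]] carrier_vecD[OF T_carr[OF PD[OF P]]] in \<open>simp only:\<close>)
  qed
  have zero: "\<forall>i<?k. 0\<^sub>v n \<in> Ws ! i"
    using sub' is_subspace_zero by blast
  have T0: "T (\<lambda>_. 0\<^sub>v n) = 0\<^sub>v n"
    using T_carr[OF zero] T_index[OF zero] by (intro eq_vecI) simp_all
  have "subspace_sum n Ws = T ` P"
  proof (intro equalityI subsetI)
    fix y assume "y \<in> subspace_sum n Ws"
    then obtain w where "y = T w" and w: "\<forall>i<?k. w i \<in> Ws ! i"
      unfolding subspace_sum_def T_def by blast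
    then show "y \<in> T ` P"
      using restrict[OF w] by (intro image_eqI[of _ _ "restrict w {..<?k}"]) simp_all
  next
    fix y assume "y \<in> T ` P"
    then show "y \<in> subspace_sum n Ws"
      using PD unfolding subspace_sum_def T_def by blast
  qed
  moreover have "finite P"
    unfolding P_def using finite_subset[OF subspace_carrier[OF sub']] by (intro finite_PiE) auto
  moreover have "card P = (\<Prod>i<?k. card (Ws ! i))"
    unfolding P_def by (rule card_PiE) simp
  ultimately have "card (subspace_sum n Ws) = (\<Prod>i<?k. card (Ws ! i)) \<longleftrightarrow> inj_on T P"
    using eq_card_imp_inj_on[of P T] card_image[of T P] by metis
  also have "\<dots> \<longleftrightarrow> (\<forall>w. (\<forall>i<?k. w i \<in> Ws ! i) \<and> T w = 0\<^sub>v n \<longrightarrow> (\<forall>i<?k. w i = 0\<^sub>v n))"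
  proof safe
    fix w i assume inj: "inj_on T P" and w: "\<forall>i<?k. w i \<in> Ws ! i" and "T w = 0\<^sub>v n" and i: "i < ?k"
    then have "T (restrict w {..<?k}) = T (restrict (\<lambda>_. 0\<^sub>v n) {..<?k})"
      by (simp only: restrict(2)[OF w] restrict(2)[OF zero] T0)
    then have "restrict w {..<?k} = restrict (\<lambda>_. 0\<^sub>v n) {..<?k}"
      by (rule inj_onD[OF inj _ restrict(1)[OF w] restrict(1)[OF zero]])
    then show "w i = 0\<^sub>v n"
      using i by (metis lessThan_iff restrict_apply')
  next
    assume ker: "\<forall>w. (\<forall>i<?k. w i \<in> Ws ! i) \<and> T w = 0\<^sub>v n \<longrightarrow> (\<forall>i<?k. w i = 0\<^sub>v n)"
    show "inj_on T P"
    proof (rule inj_onI)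
      fix x y assume x: "x \<in> P" and y: "y \<in> P" and eq: "T x = T y"
      let ?w = "\<lambda>i. x i - y i"
      have w: "\<forall>i<?k. ?w i \<in> Ws ! i"
        using PD[OF x] PD[OF y] sub' is_subspace_minus by blast
      have "T ?w $ j = 0" if j: "j < n" for j
      proof -
        have "T ?w $ j = (\<Sum>i<?k. x i $ j - y i $ j)"
          unfolding T_index[OF w j] using j
          by (intro sum.cong) (simp_all add: carrier_vecD[OF carr[OF PD[OF y]]])
        also have "\<dots> = 0"
          using T_index[OF PD[OF x] j] T_index[OF PD[OF y] j] eq by (simp add: sum_subtractf)
        finally show ?thesis .
      qed
      then have "T ?w = 0\<^sub>v n"
        using T_carr[OF w] by (intro eq_vecI) auto
      then have "\<forall>i<?k. x i - y i = 0\<^sub>v n"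
        by (rule mp[OF spec[OF ker, of ?w] conjI[OF w]])
      then have *: "x i - y i = 0\<^sub>v n" if "i < ?k" for i
        using that by simp
      have "x i = y i" if i: "i < ?k" for i
      proof (rule eq_vecI)
        fix j assume "j < dim_vec (y i)"
        then show "x i $ j = y i $ j"
          using arg_cong[OF *[OF i], of "\<lambda>v. v $ j"] carrier_vecD[OF carr[OF PD[OF y] i]] by simp
      qed (simp add: carrier_vecD[OF carr[OF PD[OF x] i]] carrier_vecD[OF carr[OF PD[OF y] i]])
      then show "x = y"
        using x y by (auto simp: P_def intro: PiE_ext)
    qed
  qed
  finally show ?thesis
    by (simp add: is_direct_sum_def T_def)
qed

section \<open>Supports through functionals\<close>

locale field_extension = field_hom \<iota> for \<iota> :: "'f::field \<Rightarrow> 'e::field"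
begin

sublocale ext: vector_space "ext_scale \<iota>"
  by unfold_locales (auto simp: ext_scale_def hom_add hom_mult algebra_simps)

sublocale functionals: vector_space_pair "ext_scale \<iota>" "(*) :: 'f \<Rightarrow> 'f \<Rightarrow> 'f"
  by unfold_locales (auto simp: algebra_simps)

abbreviation functional :: "('e \<Rightarrow> 'f) \<Rightarrow> bool" where
  "functional \<equiv> Vector_Spaces.linear (ext_scale \<iota>) (*)"

lemma functional_iff:
  "functional \<phi> \<longleftrightarrow> (\<forall>x y. \<phi> (x + y) = \<phi> x + \<phi> y) \<and> (\<forall>a x. \<phi> (\<iota> a * x) = a * \<phi> x)"
  using ext.vector_space_axioms functionals.vs2.vector_space_axioms
  by (simp add: Vector_Spaces.linear_iff ext_scale_def)

lemma functionalI:
  "(\<And>x y. \<phi> (x + y) = \<phi> x + \<phi> y) \<Longrightarrow> (\<And>a x. \<phi> (\<iota> a * x) = a * \<phi> x) \<Longrightarrow> functional \<phi>"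
  by (simp add: functional_iff)

lemma functional_scale: "functional \<phi> \<Longrightarrow> \<phi> (\<iota> a * x) = a * \<phi> x"
  by (simp add: functional_iff)

lemma functional_mult_right: "functional \<phi> \<Longrightarrow> \<phi> (x * \<iota> a) = \<phi> x * a"
  by (metis functional_scale mult.commute)

lemma functional_sum_scale:
  "functional \<phi> \<Longrightarrow> \<phi> (\<Sum>i\<in>I. x i * \<iota> (a i)) = (\<Sum>i\<in>I. \<phi> (x i) * a i)"
  by (simp add: functionals.linear_sum functional_mult_right)

text \<open>Multiplication by an element of the large field is linear over the small one. This makes
  supports invariant under nonzero scalars and lets functionals absorb the coefficients of a change
  of generator matrix.\<close>

lemma functional_mult:
  assumes "functional \<phi>"
  shows "functional (\<lambda>x. \<phi> (c * x))"
proof (rule functionalI)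
  show "\<phi> (c * (x + y)) = \<phi> (c * x) + \<phi> (c * y)" for x y
    using assms by (simp add: functional_iff distrib_left)
  show "\<phi> (c * (\<iota> a * x)) = a * \<phi> (c * x)" for a x
    using functional_scale[OF assms, of a "c * x"] by (simp only: mult.left_commute)
qed

lemma functional_lincomb:
  fixes \<phi> :: "'i \<Rightarrow> 'e \<Rightarrow> 'f"
  assumes "\<And>i. functional (\<phi> i)"
  shows "functional (\<lambda>x. \<Sum>i\<in>I. a i * \<phi> i x)"
proof (rule functionalI)
  show "(\<Sum>i\<in>I. a i * \<phi> i (x + y)) = (\<Sum>i\<in>I. a i * \<phi> i x) + (\<Sum>i\<in>I. a i * \<phi> i y)" for x y
    using assms by (simp add: functional_iff distrib_left sum.distrib)
  show "(\<Sum>i\<in>I. a i * \<phi> i (\<iota> b * x)) = b * (\<Sum>i\<in>I. a i * \<phi> i x)" for b x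
    unfolding functional_scale[OF assms] sum_distrib_left by (simp only: mult.left_commute)
qed

lemma functional_sum_mult:
  fixes \<phi> :: "'i \<Rightarrow> 'e \<Rightarrow> 'f"
  assumes "\<And>i. functional (\<phi> i)"
  shows "functional (\<lambda>x. \<Sum>i\<in>I. \<phi> i (a i * x))"
  using functional_lincomb[OF functional_mult[OF assms], where a = "\<lambda>_. 1"] by simp

section \<open>Dual bases and coordinate matrices\<close>

lemma dual_basis:
  assumes "ordered_basis \<iota> m \<Gamma>"
  obtains \<delta> where "\<And>j. functional (\<delta> j)"
    "\<And>i j. i < m \<Longrightarrow> j < m \<Longrightarrow> \<delta> j (\<Gamma> ! i) = (if i = j then 1 else 0)"
    "\<And>x. x = (\<Sum>j<m. \<iota> (\<delta> j x) * \<Gamma> ! j)"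
proof -
  have len: "length \<Gamma> = m" and dist: "distinct \<Gamma>" and ind: "ext.independent (set \<Gamma>)"
    and sp: "ext.span (set \<Gamma>) = UNIV"
    using assms by (auto simp: ordered_basis_def)
  define \<delta> where "\<delta> j x = ext.representation (set \<Gamma>) x (\<Gamma> ! j)" for j x
  show thesis
  proof
    show "functional (\<delta> j)" for j
      unfolding functional_iff \<delta>_def ext_scale_def[of \<iota>, symmetric]
      by (simp add: sp ext.representation_add[OF ind] ext.representation_scale[OF ind])
    show "\<delta> j (\<Gamma> ! i) = (if i = j then 1 else 0)" if "i < m" "j < m" for i j
      using that len dist by (auto simp: \<delta>_def ext.representation_basis[OF ind] nth_eq_iff_index_eq)
    show "x = (\<Sum>j<m. \<iota> (\<delta> j x) * \<Gamma> ! j)" for x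
    proof -
      have "x = (\<Sum>b\<in>set \<Gamma>. ext_scale \<iota> (ext.representation (set \<Gamma>) x b) b)"
        using ext.sum_representation_eq[OF ind, of x "set \<Gamma>"] sp by simp
      also have "\<dots> = (\<Sum>j<m. \<iota> (\<delta> j x) * \<Gamma> ! j)"
        unfolding \<delta>_def ext_scale_def
        by (rule sum.reindex_bij_betw[symmetric]) (simp add: bij_betw_nth dist len lessThan_atLeast0)
      finally show ?thesis .
    qed
  qed
qed

text \<open>The columns of the coordinate matrix are the images of \<open>v\<close> under the dual
  functionals. Applying \<delta> to an arbitrary expansion in the basis recovers its coefficients,
  which gives the uniqueness behind the definite description.\<close>

lemma coord_mat_dual_basis:
  assumes "ordered_basis \<iota> m \<Gamma>"
  obtains \<delta> where "\<And>j. functional (\<delta> j)"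
    "\<And>x. x = (\<Sum>j<m. \<iota> (\<delta> j x) * \<Gamma> ! j)"
    "\<And>v. coord_mat \<iota> \<Gamma> v = mat (dim_vec v) m (\<lambda>(i, j). \<delta> j (v $ i))"
proof -
  obtain \<delta> where lin: "\<And>j. functional (\<delta> j)"
    and delta: "\<And>i j. i < m \<Longrightarrow> j < m \<Longrightarrow> \<delta> j (\<Gamma> ! i) = (if i = j then 1 else 0)"
    and expand: "\<And>x. x = (\<Sum>j<m. \<iota> (\<delta> j x) * \<Gamma> ! j)"
    using dual_basis[OF assms] by blast
  have len: "length \<Gamma> = m"
    using assms by (simp add: ordered_basis_def)
  have "coord_mat \<iota> \<Gamma> v = mat (dim_vec v) m (\<lambda>(i, j). \<delta> j (v $ i))" for v
  proof -
    let ?D = "mat (dim_vec v) m (\<lambda>(i, j). \<delta> j (v $ i))"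
    show "coord_mat \<iota> \<Gamma> v = ?D"
      unfolding coord_mat_def
    proof (rule the_equality, goal_cases)
      case 1
      have "v $ i = (\<Sum>j<m. \<iota> (?D $$ (i, j)) * \<Gamma> ! j)" if "i < dim_vec v" for i
        by (rule trans[OF expand sum.cong]) (simp_all add: that)
      then show ?case
        by (simp add: len)
    next
      case (2 M)
      have "M $$ (i, j) = \<delta> j (v $ i)" if "i < dim_vec v" "j < m" for i j
      proof -
        have "\<delta> j (v $ i) = \<delta> j (\<Sum>l<m. \<Gamma> ! l * \<iota> (M $$ (i, l)))"
          using 2 that by (simp add: len mult.commute)
        also have "\<dots> = (\<Sum>l<m. if l = j then M $$ (i, l) else 0)"
          unfolding functional_sum_scale[OF lin] using that delta by (intro sum.cong) auto
        finally show ?thesis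
          using that by simp
      qed
      moreover have "M \<in> carrier_mat (dim_vec v) m"
        using 2 by (simp add: len)
      ultimately show ?case
        by (intro eq_matI) auto
    qed
  qed
  then show thesis
    by (rule that[OF lin expand])
qed

text \<open>Column combinations of the coordinate matrix are combinations of dual functionals
  applied entrywise, and every functional is such a combination, with its values on
  \<open>\<Gamma>\<close> as coefficients. The right-hand side no longer mentions
  \<open>\<Gamma>\<close>, so the support is independent of the basis.\<close>

lemma supp_vec_altdef:
  assumes "ordered_basis \<iota> m \<Gamma>"
  shows "supp_vec \<iota> \<Gamma> v = {map_vec \<phi> v | \<phi>. functional \<phi>}"
proof -
  obtain \<delta> where lin: "\<And>j. functional (\<delta> j)"
    and expand: "\<And>x. x = (\<Sum>j<m. \<iota> (\<delta> j x) * \<Gamma> ! j)"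
    and coord: "coord_mat \<iota> \<Gamma> v = mat (dim_vec v) m (\<lambda>(i, j). \<delta> j (v $ i))"
    by (rule coord_mat_dual_basis[OF assms]) blast
  define D where "D = mat (dim_vec v) m (\<lambda>(i, j). \<delta> j (v $ i))"
  have "supp_vec \<iota> \<Gamma> v = {D *\<^sub>v x | x. x \<in> carrier_vec m}"
    unfolding supp_vec_def coord D_def[symmetric]
    by (subst vec_space.col_space_eq[where nc = m]) (auto simp: D_def mult_mat_vec_def)
  also have "\<dots> = {map_vec \<phi> v | \<phi>. functional \<phi>}"
  proof (intro equalityI subsetI)
    fix y assume "y \<in> {D *\<^sub>v x | x. x \<in> carrier_vec m}"
    then obtain x where x: "y = D *\<^sub>v x" "x \<in> carrier_vec m" by auto
    have "y = map_vec (\<lambda>e. \<Sum>j<m. x $ j * \<delta> j e) v"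
      using x by (intro eq_vecI) (simp_all add: D_def scalar_prod_def lessThan_atLeast0 mult.commute)
    moreover have "functional (\<lambda>e. \<Sum>j<m. x $ j * \<delta> j e)"
      by (rule functional_lincomb[OF lin])
    ultimately show "y \<in> {map_vec \<phi> v | \<phi>. functional \<phi>}"
      by (intro CollectI exI conjI)
  next
    fix y assume "y \<in> {map_vec \<phi> v | \<phi>. functional \<phi>}"
    then obtain \<phi> where y: "y = map_vec \<phi> v" and \<phi>: "functional \<phi>" by auto
    have eval: "\<phi> e = (\<Sum>j<m. \<delta> j e * \<phi> (\<Gamma> ! j))" for e
      using arg_cong[OF expand[of e], of \<phi>]
      unfolding functionals.linear_sum[OF \<phi>] functional_scale[OF \<phi>] .
    have "y = D *\<^sub>v vec m (\<lambda>j. \<phi> (\<Gamma> ! j))"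
      using y by (intro eq_vecI)
        (simp_all add: D_def scalar_prod_def lessThan_atLeast0 eval[of "v $ _"])
    then show "y \<in> {D *\<^sub>v x | x. x \<in> carrier_vec m}" by auto
  qed
  finally show ?thesis .
qed

section \<open>Weights and the sizes of supports\<close>

lemma finite_basis_of_entries:
  obtains B where "finite B" "ext.independent B" "ext.span B = ext.span {v $ i | i. i < dim_vec v}"
    "card B = rank_weight \<iota> v"
proof -
  let ?U = "{v $ i | i. i < dim_vec v}"
  obtain B where B: "B \<subseteq> ?U" "ext.independent B" "?U \<subseteq> ext.span B" "card B = ext.dim ?U"
    using ext.basis_exists by blast
  have "ext.span B = ext.span ?U"
    unfolding ext.span_eq using B ext.span_superset by blast
  moreover have "finite B"
    using B(1) by (rule finite_subset) (simp add: setcompr_eq_image)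
  ultimately show thesis
    using that B by (simp add: rank_weight_def)
qed

lemma rank_weight_eqI:
  assumes "ext.independent B" "ext.span B = ext.span {v $ i | i. i < dim_vec v}"
  shows "rank_weight \<iota> v = card B"
  using assms by (simp add: rank_weight_def ext.dim_eq_card)

lemma rank_weight_cong:
  "ext.span {v $ i | i. i < dim_vec v} = ext.span {w $ i | i. i < dim_vec w}
    \<Longrightarrow> rank_weight \<iota> v = rank_weight \<iota> w"
  by (simp add: rank_weight_def)

end

locale finite_field_extension = field_extension \<iota>
  for \<iota> :: "'f::{field,finite} \<Rightarrow> 'e::{field,finite}" +
  fixes m :: nat and \<Gamma> :: "'e list"
  assumes basis: "ordered_basis \<iota> m \<Gamma>"
begin

abbreviation supp :: "'e vec \<Rightarrow> 'f vec set" where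
  "supp \<equiv> supp_vec \<iota> \<Gamma>"

lemma supp_eq: "supp v = {map_vec \<phi> v | \<phi>. functional \<phi>}"
  by (rule supp_vec_altdef[OF basis])

text \<open>Two functionals agree on all entries of \<open>v\<close> exactly when they agree on a
  basis \<open>B\<close> of the span of the entries, and values on \<open>B\<close> can be
  prescribed freely. So elements of the support correspond to functions from \<open>B\<close> to the
  small field.\<close>

lemma card_supp: "card (supp v) = CARD('f) ^ rank_weight \<iota> v"
proof -
  obtain B where B: "finite B" "ext.independent B"
      "ext.span B = ext.span {v $ i | i. i < dim_vec v}" "card B = rank_weight \<iota> v"
    by (rule finite_basis_of_entries[of v])
  have mem: "v $ i \<in> ext.span B" if "i < dim_vec v" for i
    unfolding B(3) using that by (intro ext.span_base) auto
  have eq: "map_vec \<phi> v = map_vec \<psi> v \<longleftrightarrow> (\<forall>b\<in>B. \<phi> b = \<psi> b)"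
    if \<phi>: "functional \<phi>" and \<psi>: "functional \<psi>" for \<phi> \<psi>
  proof
    assume "map_vec \<phi> v = map_vec \<psi> v"
    then have "\<phi> x = \<psi> x" if "x \<in> {v $ i | i. i < dim_vec v}" for x
      using that by (auto simp: vec_eq_iff)
    then have "\<phi> b = \<psi> b" if "b \<in> ext.span B" for b
      by (rule functionals.linear_eq_on[OF \<phi> \<psi> that[unfolded B(3)]])
    then show "\<forall>b\<in>B. \<phi> b = \<psi> b"
      by (simp add: ext.span_base)
  next
    assume *: "\<forall>b\<in>B. \<phi> b = \<psi> b"
    have "\<phi> (v $ i) = \<psi> (v $ i)" if "i < dim_vec v" for i
      by (rule functionals.linear_eq_on[OF \<phi> \<psi> mem[OF that]]) (use * in blast)
    then show "map_vec \<phi> v = map_vec \<psi> v"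
      by (auto simp: vec_eq_iff)
  qed
  define h where "h f = map_vec (functionals.construct B f) v" for f
  have con: "functional (functionals.construct B f)" for f
    by (rule functionals.linear_construct[OF B(2)])
  have conB: "functionals.construct B f b = f b" if "b \<in> B" for f b
    by (rule functionals.construct_basis[OF B(2) that])
  have "bij_betw h (B \<rightarrow>\<^sub>E UNIV) (supp v)"
    unfolding supp_eq
  proof (intro bij_betwI')
    fix f g assume "f \<in> B \<rightarrow>\<^sub>E (UNIV :: 'f set)" "g \<in> B \<rightarrow>\<^sub>E (UNIV :: 'f set)"
    then show "h f = h g \<longleftrightarrow> f = g"
      unfolding h_def eq[OF con con] by (auto simp: conB PiE_ext)
  next
    fix f assume "f \<in> B \<rightarrow>\<^sub>E (UNIV :: 'f set)"
    then show "h f \<in> {map_vec \<phi> v |\<phi>. functional \<phi>}"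
      using con by (auto simp: h_def)
  next
    fix y assume "y \<in> {map_vec \<phi> v |\<phi>. functional \<phi>}"
    then obtain \<phi> where y: "y = map_vec \<phi> v" "functional \<phi>" by auto
    \<comment> \<open>The functional rebuilt from the values on \<open>B\<close> may differ from
      \<phi> outside the span of the entries, but it has the same effect on
      \<open>v\<close>.\<close>
    then have "y = h (restrict \<phi> B)"
      unfolding h_def y(1) eq[OF y(2) con] by (simp add: conB)
    then show "\<exists>f\<in>B \<rightarrow>\<^sub>E UNIV. y = h f" by auto
  qed
  then have "card (supp v) = card (B \<rightarrow>\<^sub>E (UNIV :: 'f set))"
    by (metis bij_betw_same_card)
  then show ?thesis
    using B by (simp add: card_PiE)
qed

end

section \<open>Weights under matrices over the small field\<close>

context field_extension
begin

lemma entries_mult_subset_span: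
  assumes A: "A \<in> carrier_mat n p" and v: "v \<in> carrier_vec n"
  shows "{vec_mat_mult v (map_mat \<iota> A) $ j | j. j < p} \<subseteq> ext.span {v $ i | i. i < n}"
proof -
  have "vec_mat_mult v (map_mat \<iota> A) $ j = (\<Sum>i<n. ext_scale \<iota> (A $$ (i, j)) (v $ i))" if "j < p" for j
    using A that by (simp add: vec_mat_mult_index[of _ n p] ext_scale_def mult.commute)
  moreover have "(\<Sum>i<n. ext_scale \<iota> (A $$ (i, j)) (v $ i)) \<in> ext.span {v $ i | i. i < n}" for j
    by (intro ext.span_sum ext.span_scale ext.span_base) auto
  ultimately show ?thesis by auto
qed

lemma map_mat_hom_inverse:
  assumes "A \<in> carrier_mat n n" "B \<in> carrier_mat n n" "A * B = 1\<^sub>m n"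
  shows "map_mat \<iota> A * map_mat \<iota> B = 1\<^sub>m n"
  using assms mat_hom_mult[of A n n B n] mat_hom_one[of n] by simp

text \<open>Multiplying by \<open>A\<close> and then by \<open>B\<close> gives back
  \<open>v\<close>, so the entries of each of the two vectors are combinations of the entries of the
  other over the small field.\<close>

lemma rank_weight_mult_invertible:
  assumes A: "A \<in> carrier_mat n n" and B: "B \<in> carrier_mat n n" and AB: "A * B = 1\<^sub>m n"
    and v: "v \<in> carrier_vec n"
  shows "rank_weight \<iota> (vec_mat_mult v (map_mat \<iota> A)) = rank_weight \<iota> v"
proof -
  let ?w = "vec_mat_mult v (map_mat \<iota> A)"
  have w: "?w \<in> carrier_vec n"
    using A by auto
  have "vec_mat_mult ?w (map_mat \<iota> B) = v"
    using A B v by (simp add: vec_mat_mult_assoc[of _ n n _ n] map_mat_hom_inverse[OF A B AB] vec_mat_mult_one)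
  then have "{v $ i | i. i < n} \<subseteq> ext.span {?w $ i | i. i < n}"
    using entries_mult_subset_span[OF B w] by simp
  moreover have "{?w $ i | i. i < n} \<subseteq> ext.span {v $ i | i. i < n}"
    by (rule entries_mult_subset_span[OF A v])
  ultimately have "ext.span {?w $ i | i. i < n} = ext.span {v $ i | i. i < n}"
    unfolding ext.span_eq by simp
  then show ?thesis
    using v w by (intro rank_weight_cong) (simp_all only: carrier_vecD)
qed

text \<open>Padding adds at most the entry 0, which changes no span.\<close>

lemma rank_weight_append_zero:
  "rank_weight \<iota> (v @\<^sub>v 0\<^sub>v p) = rank_weight \<iota> v"
  "rank_weight \<iota> (0\<^sub>v p @\<^sub>v v) = rank_weight \<iota> v"
proof -
  have *: "ext.span X = ext.span Y" if "Y \<subseteq> X" "X \<subseteq> insert 0 Y" for X Y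
    using that ext.span_mono[of Y X] ext.span_mono[of X "insert 0 Y"] by (simp add: subset_antisym)
  show "rank_weight \<iota> (v @\<^sub>v 0\<^sub>v p) = rank_weight \<iota> v"
  proof (rule rank_weight_cong, rule *)
    show "{v $ i | i. i < dim_vec v} \<subseteq> {(v @\<^sub>v 0\<^sub>v p) $ i | i. i < dim_vec (v @\<^sub>v 0\<^sub>v p)}"
    proof safe
      fix i assume "i < dim_vec v"
      then show "\<exists>j. v $ i = (v @\<^sub>v 0\<^sub>v p) $ j \<and> j < dim_vec (v @\<^sub>v 0\<^sub>v p)"
        by (intro exI[of _ i]) simp
    qed
  qed auto
  show "rank_weight \<iota> (0\<^sub>v p @\<^sub>v v) = rank_weight \<iota> v"
  proof (rule rank_weight_cong, rule *)
    show "{v $ i | i. i < dim_vec v} \<subseteq> {(0\<^sub>v p @\<^sub>v v) $ i | i. i < dim_vec (0\<^sub>v p @\<^sub>v v)}"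
    proof safe
      fix i assume "i < dim_vec v"
      then show "\<exists>j. v $ i = (0\<^sub>v p @\<^sub>v v) $ j \<and> j < dim_vec (0\<^sub>v p @\<^sub>v v)"
        by (intro exI[of _ "p + i"]) simp
    qed
    show "{(0\<^sub>v p @\<^sub>v v) $ i | i. i < dim_vec (0\<^sub>v p @\<^sub>v v)} \<subseteq> insert 0 {v $ i | i. i < dim_vec v}"
    proof
      fix x assume "x \<in> {(0\<^sub>v p @\<^sub>v v) $ i | i. i < dim_vec (0\<^sub>v p @\<^sub>v v)}"
      then obtain i where i: "i < p + dim_vec v" "x = (0\<^sub>v p @\<^sub>v v) $ i" by auto
      then show "x \<in> insert 0 {v $ i | i. i < dim_vec v}"
        by (cases "i < p") (auto intro!: exI[of _ "i - p"])
    qed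
  qed
qed

section \<open>Block-diagonal matrices of full-weight rows and sums of supports\<close>

abbreviation full_rank_row :: "'e mat \<Rightarrow> nat \<Rightarrow> bool" where
  "full_rank_row u n \<equiv> u \<in> carrier_mat 1 n \<and> rank_weight \<iota> (row u 0) = n"

lemma diag_block_mat_carrier:
  "list_all2 full_rank_row us ns \<Longrightarrow> diag_block_mat us \<in> carrier_mat (length ns) (sum_list ns)"
  by (induction rule: list_all2_induct) (auto simp: Let_def)

lemma rank_weight_row_diag_block:
  assumes "list_all2 full_rank_row us ns" "i < length ns"
  shows "rank_weight \<iota> (row (diag_block_mat us) i) = ns ! i"
  using assms
proof (induction arbitrary: i rule: list_all2_induct)
  case (Cons u us n ns)
  let ?D = "diag_block_mat us"
  have u: "u \<in> carrier_mat 1 n" and D: "?D \<in> carrier_mat (length ns) (sum_list ns)"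
    using Cons diag_block_mat_carrier by auto
  have eq: "diag_block_mat (u # us) =
      four_block_mat u (0\<^sub>m 1 (sum_list ns)) (0\<^sub>m (length ns) n) ?D"
    using u D by (simp add: Let_def)
  note rows = row_four_block_mat[OF u zero_carrier_mat zero_carrier_mat D]
  show ?case
  proof (cases i)
    case 0
    then show ?thesis
      unfolding eq using Cons.hyps rows(1)[of 0] by (simp add: rank_weight_append_zero)
  next
    case (Suc i')
    then show ?thesis
      unfolding eq using Cons.prems Cons.IH[of i'] rows(2)[of i]
      by (simp add: rank_weight_append_zero)
  qed
qed simp

text \<open>This is the sum of the supports of the first \<open>k\<close> rows of \<open>M\<close>,
  with one functional chosen for each row. In this form it does not mention \<open>\<Gamma>\<close>,
  and products with matrices on either side can be followed directly.\<close>

definition support_sum :: "nat \<Rightarrow> nat \<Rightarrow> 'e mat \<Rightarrow> 'f vec set" where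
  "support_sum k n M = {y \<in> carrier_vec n. \<exists>\<phi>. (\<forall>i. functional (\<phi> i)) \<and>
     (\<forall>j<n. y $ j = (\<Sum>i<k. \<phi> i (M $$ (i, j))))}"

text \<open>The entries of \<open>P\<close> lie in the large field and cannot be pulled out of a
  functional; instead they are absorbed by precomposition, and the functionals are regrouped by the
  rows of \<open>H\<close>.\<close>

lemma support_sum_mult_left:
  assumes P: "P \<in> carrier_mat k l" and H: "H \<in> carrier_mat l n"
  shows "support_sum k n (P * H) \<subseteq> support_sum l n H"
proof
  fix y assume "y \<in> support_sum k n (P * H)"
  then obtain \<phi> where y: "y \<in> carrier_vec n" and \<phi>: "\<And>i. functional (\<phi> i)"
    and eq: "\<And>j. j < n \<Longrightarrow> y $ j = (\<Sum>i<k. \<phi> i ((P * H) $$ (i, j)))"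
    by (auto simp: support_sum_def)
  define \<psi> where "\<psi> t x = (\<Sum>i<k. \<phi> i (P $$ (i, t) * x))" for t x
  have "functional (\<psi> t)" for t
    unfolding \<psi>_def by (rule functional_sum_mult[OF \<phi>])
  moreover have "y $ j = (\<Sum>t<l. \<psi> t (H $$ (t, j)))" if "j < n" for j
  proof -
    have "\<phi> i ((P * H) $$ (i, j)) = (\<Sum>t<l. \<phi> i (P $$ (i, t) * H $$ (t, j)))" if "i < k" for i
      using P H \<open>j < n\<close> that
      by (simp add: scalar_prod_def lessThan_atLeast0 functionals.linear_sum[OF \<phi>])
    then show ?thesis
      using eq[OF that] by (simp add: \<psi>_def sum.swap[of _ "{..<l}"])
  qed
  ultimately show "y \<in> support_sum l n H"
    using y by (auto simp: support_sum_def)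
qed

text \<open>The entries of \<open>A\<close> lie in the small field, so they pass through every
  functional.\<close>

lemma support_sum_mult_right:
  assumes G: "G \<in> carrier_mat k n" and A: "A \<in> carrier_mat n p"
  shows "support_sum k p (G * map_mat \<iota> A) = (\<lambda>y. vec_mat_mult y A) ` support_sum k n G"
proof -
  have eq: "(\<Sum>i<k. \<phi> i ((G * map_mat \<iota> A) $$ (i, j))) =
      vec_mat_mult (vec n (\<lambda>l. \<Sum>i<k. \<phi> i (G $$ (i, l)))) A $ j"
    if \<phi>: "\<And>i. functional (\<phi> i)" and j: "j < p" for \<phi> :: "nat \<Rightarrow> 'e \<Rightarrow> 'f" and j
  proof -
    have "\<phi> i ((G * map_mat \<iota> A) $$ (i, j)) = (\<Sum>l<n. \<phi> i (G $$ (i, l)) * A $$ (l, j))" if "i < k" for i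
      using G A j that functional_sum_scale[OF \<phi>]
      by (simp add: scalar_prod_def lessThan_atLeast0)
    then show ?thesis
      using A j by (simp add: vec_mat_mult_index[of _ n p] sum_distrib_right sum.swap[of _ "{..<n}"])
  qed
  show ?thesis
  proof (intro equalityI subsetI)
    fix y assume "y \<in> support_sum k p (G * map_mat \<iota> A)"
    then obtain \<phi> where y: "y \<in> carrier_vec p" and \<phi>: "\<And>i. functional (\<phi> i)"
      and yj: "\<And>j. j < p \<Longrightarrow> y $ j = (\<Sum>i<k. \<phi> i ((G * map_mat \<iota> A) $$ (i, j)))"
      by (auto simp: support_sum_def)
    let ?x = "vec n (\<lambda>l. \<Sum>i<k. \<phi> i (G $$ (i, l)))"
    have "y = vec_mat_mult ?x A"
      using y A yj eq[OF \<phi>] by (intro eq_vecI) simp_all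
    moreover have "?x \<in> support_sum k n G"
      using \<phi> by (auto simp: support_sum_def)
    ultimately show "y \<in> (\<lambda>y. vec_mat_mult y A) ` support_sum k n G"
      by (rule image_eqI)
  next
    fix y assume "y \<in> (\<lambda>y. vec_mat_mult y A) ` support_sum k n G"
    then obtain x \<phi> where y: "y = vec_mat_mult x A" and x: "x \<in> carrier_vec n"
      and \<phi>: "\<And>i. functional (\<phi> i)" and xl: "\<And>l. l < n \<Longrightarrow> x $ l = (\<Sum>i<k. \<phi> i (G $$ (i, l)))"
      by (auto simp: support_sum_def)
    have "x = vec n (\<lambda>l. \<Sum>i<k. \<phi> i (G $$ (i, l)))"
      using x xl by (intro eq_vecI) simp_all
    then have "y $ j = (\<Sum>i<k. \<phi> i ((G * map_mat \<iota> A) $$ (i, j)))" if "j < p" for j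
      using y eq[OF \<phi> that] by simp
    then show "y \<in> support_sum k p (G * map_mat \<iota> A)"
      using y A \<phi> by (auto simp: support_sum_def)
  qed
qed

text \<open>Each generator matrix is a left multiple of the other, so both inclusions follow from
  the case of left multiplication.\<close>

lemma support_sum_generator_matrix:
  assumes "generator_matrix k n G C" "generator_matrix l n H C"
  shows "support_sum k n G = support_sum l n H"
proof -
  have "support_sum k n G \<subseteq> support_sum l n H"
    if GH: "generator_matrix k n G C" "generator_matrix l n H C" for k l G H
  proof -
    obtain P where "P \<in> carrier_mat k l" "G = P * H"
      using generator_matrix_factor[OF GH] .
    then show ?thesis
      using support_sum_mult_left[of P k l H n] GH(2) by (simp add: generator_matrix_def)
  qed
  then show ?thesis
    using assms by blast
qed

end

section \<open>Factoring through rows of full weight\<close>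

context field_extension
begin

text \<open>The row \<open>u\<close> lists a basis of the span of the entries of \<open>v\<close>,
  and column \<open>j\<close> of \<open>A\<close> holds the coordinates of the \<open>j\<close>-th
  entry in that basis.\<close>

lemma vec_factor_full_rank_row:
  assumes v: "v \<in> carrier_vec n"
  obtains u A where "full_rank_row u (rank_weight \<iota> v)" "A \<in> carrier_mat (rank_weight \<iota> v) n"
    "v = vec_mat_mult (row u 0) (map_mat \<iota> A)"
proof -
  obtain B where B: "finite B" "ext.independent B"
      "ext.span B = ext.span {v $ i | i. i < dim_vec v}" "card B = rank_weight \<iota> v"
    by (rule finite_basis_of_entries[of v])
  obtain bs where bs: "set bs = B" "distinct bs"
    using finite_distinct_list[OF B(1)] by blast
  define r where "r = rank_weight \<iota> v"
  have len: "length bs = r"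
    using bs B(4) distinct_card[of bs] by (simp add: r_def)
  define u where "u = mat 1 r (\<lambda>(_, i). bs ! i)"
  define A where "A = mat r n (\<lambda>(i, j). ext.representation B (v $ j) (bs ! i))"
  have row: "row u 0 = vec_of_list bs"
    by (intro eq_vecI) (simp_all add: u_def len vec_of_list_index)
  have "rank_weight \<iota> (row u 0) = card B"
  proof (rule rank_weight_eqI[OF B(2)])
    have "{row u 0 $ i | i. i < dim_vec (row u 0)} = B"
      unfolding row bs(1)[symmetric] set_conv_nth by (simp add: vec_of_list_index)
    then show "ext.span B = ext.span {row u 0 $ i | i. i < dim_vec (row u 0)}" by simp
  qed
  then have "full_rank_row u r"
    using B(4) by (simp add: r_def u_def)
  moreover have "A \<in> carrier_mat r n"
    by (simp add: A_def)
  moreover have "v = vec_mat_mult (row u 0) (map_mat \<iota> A)"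
  proof (rule eq_vecI)
    fix j assume "j < dim_vec (vec_mat_mult (row u 0) (map_mat \<iota> A))"
    then have j: "j < n" by (simp add: A_def)
    have "v $ j \<in> ext.span B"
      unfolding B(3) using j v by (intro ext.span_base) auto
    then have "v $ j = (\<Sum>b\<in>B. ext_scale \<iota> (ext.representation B (v $ j) b) b)"
      using ext.sum_representation_eq[OF B(2) _ B(1) subset_refl, of "v $ j"] by simp
    also have "\<dots> = (\<Sum>i<r. \<iota> (A $$ (i, j)) * bs ! i)"
      using j bs len
      by (intro sum.reindex_bij_betw[symmetric, of "\<lambda>i. bs ! i", THEN trans])
        (auto simp: bij_betw_nth lessThan_atLeast0 ext_scale_def A_def intro!: sum.cong)
    also have "\<dots> = vec_mat_mult (row u 0) (map_mat \<iota> A) $ j"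
      using j by (simp add: vec_mat_mult_index[of _ r n] A_def u_def mult.commute)
    finally show "v $ j = vec_mat_mult (row u 0) (map_mat \<iota> A) $ j" .
  qed (use v in \<open>simp add: A_def\<close>)
  ultimately show thesis
    using that by (simp add: r_def)
qed

text \<open>Each row is factored separately; the full-weight rows become diagonal blocks, and their
  coefficient matrices are stacked into \<open>A\<close>.\<close>

lemma mat_of_rows_factor:
  assumes "set cs \<subseteq> carrier_vec n"
  shows "\<exists>us A. list_all2 full_rank_row us (map (rank_weight \<iota>) cs) \<and>
    A \<in> carrier_mat (sum_list (map (rank_weight \<iota>) cs)) n \<and>
    mat_of_rows n cs = diag_block_mat us * map_mat \<iota> A"
  using assms
proof (induction cs)
  case Nil
  \<comment> \<open>With no rows the inner dimension is 0 too, but \<open>n\<close> columns must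
    survive, hence a factor of size 0 by \<open>n\<close>.\<close>
  have "mat_of_rows n [] = (0\<^sub>m 0 0 :: 'e mat) * map_mat \<iota> (0\<^sub>m 0 n)"
    by (rule eq_matI) simp_all
  then show ?case
    by (intro exI[of _ "[]"] exI[of _ "0\<^sub>m 0 n"]) simp
next
  case (Cons c cs)
  let ?r = "rank_weight \<iota> c" and ?N = "sum_list (map (rank_weight \<iota>) cs)"
  obtain us A where us: "list_all2 full_rank_row us (map (rank_weight \<iota>) cs)"
    and A: "A \<in> carrier_mat ?N n" and eq: "mat_of_rows n cs = diag_block_mat us * map_mat \<iota> A"
    using Cons by auto
  obtain u B where u: "full_rank_row u ?r" and B: "B \<in> carrier_mat ?r n"
    and c: "c = vec_mat_mult (row u 0) (map_mat \<iota> B)"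
    using vec_factor_full_rank_row[of c n] Cons.prems by auto
  define D where "D = diag_block_mat us"
  have D: "D \<in> carrier_mat (length cs) ?N"
    using diag_block_mat_carrier[OF us] by (simp add: D_def)
  have u1: "u \<in> carrier_mat 1 ?r" using u by simp
  have AB: "B @\<^sub>r A \<in> carrier_mat (?r + ?N) n"
    using A B by simp
  have "diag_block_mat (u # us) = four_block_mat u (0\<^sub>m 1 ?N) (0\<^sub>m (length cs) ?r) D"
    using u1 D by (simp add: D_def Let_def)
  \<comment> \<open>Stacking is a four-block matrix whose right-hand blocks have width 0; in this
    form the product rule for four blocks applies.\<close>
  moreover have "map_mat \<iota> (B @\<^sub>r A) =
      four_block_mat (map_mat \<iota> B) (0\<^sub>m ?r 0) (map_mat \<iota> A) (0\<^sub>m ?N 0)"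
    using A B by (intro eq_matI) (auto simp: append_rows_def)
  ultimately have "diag_block_mat (u # us) * map_mat \<iota> (B @\<^sub>r A) =
      four_block_mat (u * map_mat \<iota> B) (0\<^sub>m 1 0) (D * map_mat \<iota> A) (0\<^sub>m (length cs) 0)"
    using u1 D A B
    by (simp only:, subst mult_four_block_mat[of _ 1 ?r _ ?N _ "length cs" _ _ n _ 0]) auto
  also have "\<dots> = mat_of_rows n (c # cs)"
  proof (rule eq_rowI)
    fix i assume "i < dim_row (mat_of_rows n (c # cs))"
    then have i: "i < Suc (length cs)" by simp
    have row: "row (u * map_mat \<iota> B) 0 = c"
      unfolding c using u1 B by (intro row_mult_mat) auto
    \<comment> \<open>A row of a block of width 0 is an empty vector, and appending it has no
      effect.\<close>
    have app: "x @\<^sub>v vec 0 f = x" for x :: "'e vec" and f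
      by (intro eq_vecI) simp_all
    have uB: "u * map_mat \<iota> B \<in> carrier_mat 1 n"
      and DA: "D * map_mat \<iota> A \<in> carrier_mat (length cs) n"
      using u1 D A B by auto
    note rows = row_four_block_mat[OF uB zero_carrier_mat[of 1 0] DA zero_carrier_mat[of _ 0], of i]
    show "row (four_block_mat (u * map_mat \<iota> B) (0\<^sub>m 1 0) (D * map_mat \<iota> A) (0\<^sub>m (length cs) 0)) i =
        row (mat_of_rows n (c # cs)) i"
    proof (cases i)
      case 0
      then show ?thesis
        using rows(1) row Cons.prems by (simp add: zero_vec_def app)
    next
      case (Suc i')
      then show ?thesis
        using rows(2) i Cons.prems by (simp add: zero_vec_def app D_def eq[symmetric] subset_iff)
    qed
  qed (use u1 D A B in auto)
  finally show ?case
    using us u AB by (intro exI[of _ "u # us"] exI[of _ "B @\<^sub>r A"]) simp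
qed

end

section \<open>Supports of codes\<close>

context finite_field_extension
begin

lemma supp_carrier: "v \<in> carrier_vec n \<Longrightarrow> supp v \<subseteq> carrier_vec n"
  by (auto simp: supp_eq)

lemma is_subspace_supp:
  assumes "v \<in> carrier_vec n"
  shows "is_subspace n (supp v)"
proof -
  interpret vec_space "TYPE('f)" n .
  obtain \<delta> where "coord_mat \<iota> \<Gamma> v = mat (dim_vec v) m (\<lambda>(i, j). \<delta> j (v $ i))"
    by (rule coord_mat_dual_basis[OF basis]) blast
  then have "coord_mat \<iota> \<Gamma> v \<in> carrier_mat n m"
    using assms by simp
  then have "set (cols (coord_mat \<iota> \<Gamma> v)) \<subseteq> carrier_vec n"
    using cols_dim by blast
  then show ?thesis
    using assms span_is_subspace[of "set (cols (coord_mat \<iota> \<Gamma> v))"]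
    by (simp add: is_subspace_def supp_vec_def col_space_def)
qed

lemma card_field_gt_1: "CARD('f) > 1"
  using card_mono[of UNIV "{0, 1 :: 'f}"] by simp

text \<open>Both numbers are the exponent of the size of the small field in the cardinality of the
  support.\<close>

lemma subspace_dim_supp:
  assumes "v \<in> carrier_vec n"
  shows "subspace_dim n (supp v) = rank_weight \<iota> v"
  using card_subspace[OF is_subspace_supp[OF assms]] card_supp[of v] card_field_gt_1
  by (simp add: power_inject_exp)

lemma subspace_sum_supp:
  assumes "set cs \<subseteq> carrier_vec n"
  shows "subspace_sum n (map supp cs) = support_sum (length cs) n (mat_of_rows n cs)"
proof (intro equalityI subsetI)
  fix y assume "y \<in> subspace_sum n (map supp cs)"
  then obtain w where y: "y = finsum_vec TYPE('f) n w {..<length cs}"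
    and w: "\<And>i. i < length cs \<Longrightarrow> w i \<in> supp (cs ! i)"
    by (auto simp: subspace_sum_def)
  \<comment> \<open>\<open>support_sum\<close> demands a functional at every natural index, so
    indices past the end of the list receive the zero functional.\<close>
  have "\<exists>\<phi>. functional \<phi> \<and> (i < length cs \<longrightarrow> w i = map_vec \<phi> (cs ! i))" for i
  proof (cases "i < length cs")
    case True
    then show ?thesis
      using w[OF True] by (auto simp: supp_eq)
  next
    case False
    then show ?thesis
      using functionals.linear_zero by blast
  qed
  then obtain \<phi> where \<phi>: "\<And>i. functional (\<phi> i)"
    and w\<phi>: "\<And>i. i < length cs \<Longrightarrow> w i = map_vec (\<phi> i) (cs ! i)"
    by metis
  have cs: "cs ! i \<in> carrier_vec n" if "i < length cs" for i
    using assms that by auto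
  have wc: "w i \<in> carrier_vec n" if "i < length cs" for i
    using w\<phi>[OF that] cs[OF that] by simp
  have yc: "y \<in> carrier_vec n"
    unfolding y by (rule finsum_vec_lessThan(1)) (rule wc)
  have "y $ j = (\<Sum>i<length cs. \<phi> i (mat_of_rows n cs $$ (i, j)))" if j: "j < n" for j
  proof -
    have "y $ j = (\<Sum>i<length cs. w i $ j)"
      unfolding y using j by (intro finsum_vec_lessThan(2)) (simp_all add: wc)
    also have "\<dots> = (\<Sum>i<length cs. \<phi> i (mat_of_rows n cs $$ (i, j)))"
      using j w\<phi> by (intro sum.cong) (simp_all add: mat_of_rows_index carrier_vecD[OF cs])
    finally show ?thesis .
  qed
  then show "y \<in> support_sum (length cs) n (mat_of_rows n cs)"
    using \<phi> yc by (auto simp: support_sum_def)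
next
  fix y assume "y \<in> support_sum (length cs) n (mat_of_rows n cs)"
  then obtain \<phi> where y: "y \<in> carrier_vec n" and \<phi>: "\<And>i. functional (\<phi> i)"
    and yj: "\<And>j. j < n \<Longrightarrow> y $ j = (\<Sum>i<length cs. \<phi> i (mat_of_rows n cs $$ (i, j)))"
    by (auto simp: support_sum_def)
  have cs: "cs ! i \<in> carrier_vec n" if "i < length cs" for i
    using assms that by auto
  let ?w = "\<lambda>i. map_vec (\<phi> i) (cs ! i)"
  have wc: "?w i \<in> carrier_vec n" if "i < length cs" for i
    using cs[OF that] by simp
  have fin: "finsum_vec TYPE('f) n ?w {..<length cs} \<in> carrier_vec n"
    by (rule finsum_vec_lessThan(1)) (rule wc)
  have "y = finsum_vec TYPE('f) n ?w {..<length cs}"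
  proof (rule eq_vecI)
    fix j assume "j < dim_vec (finsum_vec TYPE('f) n ?w {..<length cs})"
    then have j: "j < n" using fin by simp
    have "y $ j = (\<Sum>i<length cs. ?w i $ j)"
      unfolding yj[OF j] using j by (intro sum.cong) (simp_all add: mat_of_rows_index carrier_vecD[OF cs])
    also have "\<dots> = finsum_vec TYPE('f) n ?w {..<length cs} $ j"
      using j by (intro finsum_vec_lessThan(2)[symmetric]) (simp_all only: wc)
    finally show "y $ j = finsum_vec TYPE('f) n ?w {..<length cs} $ j" .
  qed (use y fin in simp)
  moreover have "?w i \<in> map supp cs ! i" if "i < length cs" for i
    using that \<phi> by (auto simp: supp_eq)
  ultimately show "y \<in> subspace_sum n (map supp cs)"
    by (auto simp: subspace_sum_def)
qed

text \<open>Frees the support of a code from the basis chosen in \<open>supp_code\<close>: any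
  generator matrix with \<open>k\<close> rows computes it.\<close>

lemma supp_code_eq:
  assumes C: "is_code n k C" and G: "generator_matrix k n G C"
  shows "supp_code \<iota> \<Gamma> n C = support_sum k n G"
proof -
  define cs where "cs = (SOME cs. code_basis n C cs)"
  have "code_basis n C cs"
    unfolding cs_def using code_basis_exists[OF C] by (metis someI)
  moreover have len: "length cs = k"
    using code_basis_length[OF C] calculation .
  ultimately have "set cs \<subseteq> carrier_vec n" "generator_matrix k n (mat_of_rows n cs) C"
    using code_basis_iff_generator_matrix[OF C] by auto
  then show ?thesis
    using support_sum_generator_matrix[OF G] len
    by (simp add: supp_code_def subspace_sum_supp flip: cs_def)
qed

text \<open>A row of full weight has a support as large as the whole space, so every vector arises
  from it by a functional.\<close>

lemma full_rank_row_supp: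
  assumes "full_rank_row u n" "y \<in> carrier_vec n"
  obtains \<phi> where "functional \<phi>" "y = map_vec \<phi> (row u 0)"
proof -
  have r: "row u 0 \<in> carrier_vec n"
    using assms(1) by (intro row_carrier_vec[of 0 1]) simp_all
  have "supp (row u 0) = carrier_vec n"
    using assms(1) supp_carrier[OF r]
    by (intro card_subset_eq) (simp_all add: card_supp card_carrier_vec)
  then show thesis
    using assms(2) that by (auto simp: supp_eq)
qed

text \<open>A target vector is cut at the block boundaries, and each piece is reached by a
  functional on its own block; off the blocks the functionals only meet zeros.\<close>

lemma support_sum_diag_block:
  assumes "list_all2 full_rank_row us ns"
  shows "support_sum (length ns) (sum_list ns) (diag_block_mat us) = carrier_vec (sum_list ns)"
proof -
  have "y \<in> support_sum (length ns) (sum_list ns) (diag_block_mat us)"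
    if "y \<in> carrier_vec (sum_list ns)" for y
    using assms that
  proof (induction arbitrary: y rule: list_all2_induct)
    case Nil
    then show ?case
      using functionals.linear_zero by (auto simp: support_sum_def)
  next
    case (Cons u us n ns)
    let ?N = "sum_list ns" and ?D = "diag_block_mat us"
    have u: "u \<in> carrier_mat 1 n" and D: "?D \<in> carrier_mat (length ns) ?N"
      using Cons diag_block_mat_carrier by auto
    have y: "y \<in> carrier_vec (n + ?N)"
      using Cons.prems by simp
    obtain \<phi> where \<phi>: "functional \<phi>" "vec_first y n = map_vec \<phi> (row u 0)"
      using full_rank_row_supp[OF Cons.hyps(1) vec_first_carrier] .
    obtain \<psi> where \<psi>: "\<And>i. functional (\<psi> i)"
      and last: "\<And>j. j < ?N \<Longrightarrow> vec_last y ?N $ j = (\<Sum>i<length ns. \<psi> i (?D $$ (i, j)))"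
      using Cons.IH[OF vec_last_carrier, of y] unfolding support_sum_def by blast
    \<comment> \<open>The new block contributes row 0, so the functionals of the induction
      hypothesis move up by one index.\<close>
    define \<chi> where "\<chi> = case_nat \<phi> \<psi>"
    have \<chi>: "functional (\<chi> i)" for i
      using \<phi>(1) \<psi> by (simp add: \<chi>_def split: nat.split)
    have first: "y $ j = \<phi> (u $$ (0, j))" if "j < n" for j
      using arg_cong[OF \<phi>(2), of "\<lambda>v. v $ j"] that u by (simp add: vec_first_def)
    have last': "y $ j = (\<Sum>i<length ns. \<psi> i (?D $$ (i, j - n)))" if "n \<le> j" "j < n + ?N" for j
      using last[of "j - n"] that y by (simp add: vec_last_def)
    have "y $ j = (\<Sum>i<length (n # ns). \<chi> i (diag_block_mat (u # us) $$ (i, j)))"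
      if "j < n + ?N" for j
    proof (cases "j < n")
      case True
      then show ?thesis
        using that u D first functionals.linear_0[OF \<psi>]
        by (simp add: \<chi>_def Let_def sum.lessThan_Suc_shift del: sum.lessThan_Suc)
    next
      case False
      then show ?thesis
        using that u D last'[of j] functionals.linear_0[OF \<phi>(1)]
        by (simp add: \<chi>_def Let_def sum.lessThan_Suc_shift del: sum.lessThan_Suc)
    qed
    then show ?case
      using \<chi> y by (auto simp: support_sum_def)
  qed
  then show ?thesis
    by (auto simp: support_sum_def)
qed

end

section \<open>The four conditions\<close>

context finite_field_extension
begin

section \<open>Scalar multiples and one-dimensional MRD codes\<close>

lemma supp_smult_subset: "supp (c \<cdot>\<^sub>v v) \<subseteq> supp v"
proof
  fix y assume "y \<in> supp (c \<cdot>\<^sub>v v)"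
  then obtain \<phi> where "functional \<phi>" "y = map_vec \<phi> (c \<cdot>\<^sub>v v)"
    by (auto simp: supp_eq)
  moreover have "map_vec \<phi> (c \<cdot>\<^sub>v v) = map_vec (\<lambda>x. \<phi> (c * x)) v"
    by (intro eq_vecI) simp_all
  ultimately show "y \<in> supp v"
    using functional_mult[of \<phi> c] unfolding supp_eq by blast
qed

lemma rank_weight_eq_iff: "rank_weight \<iota> v = r \<longleftrightarrow> card (supp v) = CARD('f) ^ r"
  using card_supp[of v] card_field_gt_1 by (simp add: power_inject_exp)

text \<open>The inclusion of supports, used for \<open>c\<close> and for its inverse, shows that the
  supports coincide, and the support determines the weight.\<close>

lemma rank_weight_smult:
  assumes "c \<noteq> 0"
  shows "rank_weight \<iota> (c \<cdot>\<^sub>v v) = rank_weight \<iota> v"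
proof -
  have "supp v = supp (c \<cdot>\<^sub>v v)"
    using supp_smult_subset[of c v] supp_smult_subset[of "inverse c" "c \<cdot>\<^sub>v v"] assms
    by (simp add: smult_smult_assoc)
  then show ?thesis
    using rank_weight_eq_iff[of "c \<cdot>\<^sub>v v" "rank_weight \<iota> v"] card_supp[of v] by simp
qed

lemma rank_weight_zero: "rank_weight \<iota> (0\<^sub>v n) = 0"
proof -
  have "map_vec \<phi> (0\<^sub>v n) = 0\<^sub>v n" if "functional \<phi>" for \<phi>
    using functionals.linear_0[OF that] by (intro eq_vecI) simp_all
  then have "supp (0\<^sub>v n) \<subseteq> {0\<^sub>v n}"
    by (auto simp: supp_eq)
  then have "card (supp (0\<^sub>v n)) \<le> 1"
    using card_mono[of "{0\<^sub>v n}"] by simp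
  then show ?thesis
    using card_supp[of "0\<^sub>v n"] card_field_gt_1 one_less_power[of "CARD('f)"] by (metis gr0I not_le)
qed

lemma generator_matrix_1:
  assumes "generator_matrix 1 n u C"
  shows "C = range (\<lambda>a. a \<cdot>\<^sub>v row u 0)" "row u 0 \<in> carrier_vec n"
proof -
  have u: "u \<in> carrier_mat 1 n" and C: "C = {vec_mat_mult x u | x. x \<in> carrier_vec 1}"
    using assms by (simp_all add: generator_matrix_def)
  show "row u 0 \<in> carrier_vec n"
    using u by (intro row_carrier_vec[of 0 1]) simp_all
  have eq: "vec_mat_mult x u = (x $ 0) \<cdot>\<^sub>v row u 0" for x
    using u by (intro eq_vecI) (simp_all add: vec_mat_mult_index[of _ 1 n])
  have "\<exists>x. a \<cdot>\<^sub>v row u 0 = vec_mat_mult x u \<and> x \<in> carrier_vec 1" for a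
    by (intro exI[of _ "vec 1 (\<lambda>_. a)"]) (simp add: eq)
  then show "C = range (\<lambda>a. a \<cdot>\<^sub>v row u 0)"
    unfolding C using eq by blast
qed

lemma inj_smult:
  assumes "v \<noteq> 0\<^sub>v n" "v \<in> carrier_vec n"
  shows "inj (\<lambda>a. a \<cdot>\<^sub>v (v :: 'e vec))"
proof (rule injI)
  fix a b assume eq: "a \<cdot>\<^sub>v v = b \<cdot>\<^sub>v v"
  obtain i where i: "i < n" "v $ i \<noteq> 0"
    using assms by (metis carrier_vecD eq_vecI index_zero_vec)
  then show "a = b"
    using arg_cong[OF eq, of "\<lambda>x. x $ i"] assms by simp
qed

text \<open>The difference of two distinct codewords is a nonzero multiple of the generator, so all
  distances between distinct codewords are equal.\<close>

lemma min_dist_1: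
  assumes G: "generator_matrix 1 n u C" and nz: "row u 0 \<noteq> 0\<^sub>v n"
  shows "min_dist \<iota> C = rank_weight \<iota> (row u 0)"
proof -
  let ?v = "row u 0"
  note C = generator_matrix_1[OF G]
  have inj: "a \<cdot>\<^sub>v ?v = b \<cdot>\<^sub>v ?v \<longleftrightarrow> a = b" for a b
    using inj_smult[OF nz C(2)] by (auto dest: injD)
  have dist: "rank_dist \<iota> (a \<cdot>\<^sub>v ?v) (b \<cdot>\<^sub>v ?v) = rank_weight \<iota> ?v" if "a \<noteq> b" for a b
  proof -
    have "a \<cdot>\<^sub>v ?v - b \<cdot>\<^sub>v ?v = (a - b) \<cdot>\<^sub>v ?v"
      by (intro eq_vecI) (simp_all add: left_diff_distrib)
    then show ?thesis
      using that by (simp add: rank_dist_def rank_weight_smult)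
  qed
  have "{rank_dist \<iota> x y | x y. x \<in> C \<and> y \<in> C \<and> x \<noteq> y} = {rank_weight \<iota> ?v}"
  proof (intro equalityI subsetI)
    fix d assume "d \<in> {rank_dist \<iota> x y | x y. x \<in> C \<and> y \<in> C \<and> x \<noteq> y}"
    then obtain a b where "d = rank_dist \<iota> (a \<cdot>\<^sub>v ?v) (b \<cdot>\<^sub>v ?v)" "a \<cdot>\<^sub>v ?v \<noteq> b \<cdot>\<^sub>v ?v"
      unfolding C(1) by blast
    then show "d \<in> {rank_weight \<iota> ?v}"
      using dist[of a b] by force
  next
    fix d assume "d \<in> {rank_weight \<iota> ?v}"
    \<comment> \<open>The distance is attained by the zero codeword and the generator.\<close>
    then have "d = rank_dist \<iota> (0 \<cdot>\<^sub>v ?v) (1 \<cdot>\<^sub>v ?v)" "0 \<cdot>\<^sub>v ?v \<noteq> 1 \<cdot>\<^sub>v ?v"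
      using dist[of 0 1] inj[of 0 1] by simp_all
    then show "d \<in> {rank_dist \<iota> x y | x y. x \<in> C \<and> y \<in> C \<and> x \<noteq> y}"
      unfolding C(1) by blast
  qed
  then show ?thesis
    by (simp add: min_dist_def)
qed

text \<open>For \<open>n < m\<close> and dimension one the defining equation reads
  \<open>m = m * (n - d + 1)\<close>, that is \<open>d = n\<close>, and the minimum distance is the
  weight of a generator.\<close>

lemma is_mrd_1_iff:
  assumes n: "1 \<le> n" "n < m"
  shows "is_mrd \<iota> m n 1 C \<longleftrightarrow> (\<exists>u. full_rank_row u n \<and> generator_matrix 1 n u C)"
proof
  assume mrd: "is_mrd \<iota> m n 1 C"
  then have code: "is_code n 1 C"
    by (simp add: is_mrd_def)
  then obtain cs where cs: "length cs = 1" "code_basis n C cs"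
    using code_basis_exists by blast
  define u where "u = mat_of_rows n cs"
  have G: "generator_matrix 1 n u C"
    using code_basis_iff_generator_matrix[OF code cs(1)] cs(2) by (simp add: u_def)
  note C = generator_matrix_1[OF G]
  \<comment> \<open>A code with more than one element cannot have a zero generator.\<close>
  have "card C = CARD('e)"
    using card_subspace[of n C] code by (simp add: is_code_def)
  have "row u 0 \<noteq> 0\<^sub>v n"
  proof
    assume "row u 0 = 0\<^sub>v n"
    moreover have "a \<cdot>\<^sub>v 0\<^sub>v n = 0\<^sub>v n" for a :: 'e
      by (intro eq_vecI) simp_all
    ultimately have "C = {0\<^sub>v n}"
      unfolding C(1) by simp
    then show False
      using \<open>card C = CARD('e)\<close> card_mono[of UNIV "{0, 1 :: 'e}"] by simp
  qed
  then have "min_dist \<iota> C = rank_weight \<iota> (row u 0)"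
    by (rule min_dist_1[OF G])
  moreover have "int m * 1 = int m * (int n - int (min_dist \<iota> C) + 1)"
    using mrd n by (simp add: is_mrd_def)
  then have "int n = int (min_dist \<iota> C)"
    using n by (simp only: mult_cancel_left) simp
  ultimately have "full_rank_row u n"
    using G by (simp add: generator_matrix_def)
  then show "\<exists>u. full_rank_row u n \<and> generator_matrix 1 n u C"
    using G by blast
next
  assume "\<exists>u. full_rank_row u n \<and> generator_matrix 1 n u C"
  then obtain u where u: "full_rank_row u n" and G: "generator_matrix 1 n u C" by blast
  note C = generator_matrix_1[OF G]
  have nz: "row u 0 \<noteq> 0\<^sub>v n"
    using u n rank_weight_zero[of n] by auto
  have sub: "is_subspace n C"
    by (rule is_subspace_of_generator_matrix[OF G])
  \<comment> \<open>Counting the multiples of a nonzero generator determines the dimension.\<close>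
  have "card C = CARD('e)"
    unfolding C(1) by (rule card_image[OF inj_smult[OF nz C(2)]])
  then have "CARD('e) ^ subspace_dim n C = CARD('e) ^ 1"
    using card_subspace[OF sub] by simp
  moreover have "CARD('e) > 1"
    using card_mono[of UNIV "{0, 1 :: 'e}"] by simp
  ultimately have "subspace_dim n C = 1"
    by (simp only: power_inject_exp)
  then show "is_mrd \<iota> m n 1 C"
    using sub min_dist_1[OF G nz] u n by (simp add: is_mrd_def is_code_def)
qed

section \<open>Comparison of the four conditions\<close>

lemma has_block_diag_generator_iff:
  assumes "length ns = k"
  shows "has_block_diag_generator \<iota> n k ns C \<longleftrightarrow>
    (\<exists>C' us. code_equiv \<iota> n C C' \<and> list_all2 full_rank_row us ns \<and>
      generator_matrix k n (diag_block_mat us) C')"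
proof -
  have "list_all2 full_rank_row us ns \<longleftrightarrow> length us = k \<and> (\<forall>i<k. full_rank_row (us ! i) (ns ! i))" for us
    using assms by (auto simp: list_all2_conv_all_nth)
  then show ?thesis
    unfolding has_block_diag_generator_def by blast
qed

text \<open>Summands and blocks correspond one by one: an MRD summand supplies a full-weight row
  generating it, and conversely each block yields its row space.\<close>

lemma equivalent_to_sum_of_mrd_iff_block_diag:
  assumes len: "length ns = k" and ns: "\<And>i. i < k \<Longrightarrow> 1 \<le> ns ! i \<and> ns ! i < m"
  shows "equivalent_to_sum_of_mrd \<iota> m n k ns C \<longleftrightarrow> has_block_diag_generator \<iota> n k ns C"
proof
  assume "equivalent_to_sum_of_mrd \<iota> m n k ns C"
  then obtain Cs where Cs: "length Cs = k" "\<And>i. i < k \<Longrightarrow> is_mrd \<iota> m (ns ! i) 1 (Cs ! i)"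
    and eq: "code_equiv \<iota> n C (ext_direct_sum Cs)"
    by (auto simp: equivalent_to_sum_of_mrd_def)
  have "\<exists>u. full_rank_row u (ns ! i) \<and> generator_matrix 1 (ns ! i) u (Cs ! i)" if "i < k" for i
    using is_mrd_1_iff ns[OF that] Cs(2)[OF that] by blast
  then obtain u where u: "\<And>i. i < k \<Longrightarrow> full_rank_row (u i) (ns ! i)"
    and G: "\<And>i. i < k \<Longrightarrow> generator_matrix 1 (ns ! i) (u i) (Cs ! i)"
    by metis
  define us where "us = map u [0..<k]"
  have us: "list_all2 full_rank_row us ns"
    using u len by (simp add: us_def list_all2_conv_all_nth)
  have D: "diag_block_mat us \<in> carrier_mat k (sum_list ns)"
    using diag_block_mat_carrier[OF us] len by simp
  have "list_all2 (\<lambda>u C. generator_matrix (dim_row u) (dim_col u) u C) us Cs"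
    unfolding list_all2_conv_all_nth
  proof (intro conjI allI impI)
    fix i assume "i < length us"
    then have i: "i < k" by (simp add: us_def)
    then have "dim_row (us ! i) = 1" "dim_col (us ! i) = ns ! i" "us ! i = u i"
      using u[OF i] by (auto simp: us_def)
    then show "generator_matrix (dim_row (us ! i)) (dim_col (us ! i)) (us ! i) (Cs ! i)"
      using G[OF i] by simp
  qed (simp add: us_def Cs)
  then have gen: "generator_matrix k (sum_list ns) (diag_block_mat us) (ext_direct_sum Cs)"
    using generator_matrix_ext_direct_sum[of us Cs] D by simp
  \<comment> \<open>The zero codeword has length \<open>sum_list ns\<close> by construction and
    length \<open>n\<close> by \<open>code_equiv\<close>, which forces the two to agree.\<close>
  have "vec_mat_mult (0\<^sub>v k) (diag_block_mat us) \<in> ext_direct_sum Cs"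
    using gen zero_carrier_vec unfolding generator_matrix_def by blast
  then have "vec_mat_mult (0\<^sub>v k) (diag_block_mat us) \<in> carrier_vec n"
    using eq by (auto simp: code_equiv_def)
  then have "dim_col (diag_block_mat us) = n"
    by (metis carrier_vecD dim_vec_mat_mult)
  then have "n = sum_list ns"
    using carrier_matD(2)[OF D] by simp
  then show "has_block_diag_generator \<iota> n k ns C"
    unfolding has_block_diag_generator_iff[OF len] using eq us gen by blast
next
  assume "has_block_diag_generator \<iota> n k ns C"
  then obtain C' us where eq: "code_equiv \<iota> n C C'" and us: "list_all2 full_rank_row us ns"
    and gen: "generator_matrix k n (diag_block_mat us) C'"
    unfolding has_block_diag_generator_iff[OF len] by blast
  define code where "code u = {vec_mat_mult x u | x. x \<in> carrier_vec (dim_row u)}" for u :: "'e mat"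
  have codes: "generator_matrix (dim_row u) (dim_col u) u (code u)" for u
    by (simp add: generator_matrix_def code_def)
  have "list_all2 (\<lambda>u C. generator_matrix (dim_row u) (dim_col u) u C) us (map code us)"
    using codes by (simp add: list_all2_conv_all_nth)
  then have "generator_matrix (dim_row (diag_block_mat us)) (dim_col (diag_block_mat us))
      (diag_block_mat us) (ext_direct_sum (map code us))"
    by (rule generator_matrix_ext_direct_sum)
  moreover have "dim_row (diag_block_mat us) = k"
    using gen by (auto simp: generator_matrix_def)
  ultimately have "C' = ext_direct_sum (map code us)"
    using gen by (simp add: generator_matrix_def)
  moreover have "is_mrd \<iota> m (ns ! i) 1 (code (us ! i))" if i: "i < k" for i
  proof -
    have u: "full_rank_row (us ! i) (ns ! i)"
      using us i len by (simp add: list_all2_conv_all_nth)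
    then have "generator_matrix 1 (ns ! i) (us ! i) (code (us ! i))"
      using codes[of "us ! i"] by auto
    then show ?thesis
      using is_mrd_1_iff ns[OF i] u by blast
  qed
  moreover have "length us = k"
    using us len by (simp add: list_all2_lengthD)
  ultimately show "equivalent_to_sum_of_mrd \<iota> m n k ns C"
    unfolding equivalent_to_sum_of_mrd_def using eq by (intro exI[of _ "map code us"]) simp
qed

lemma nondegenerate_iff:
  assumes "is_code n k C" "generator_matrix k n G C"
  shows "nondegenerate \<iota> \<Gamma> n C \<longleftrightarrow> support_sum k n G = carrier_vec n"
  using supp_code_eq[OF assms] by (simp add: nondegenerate_def)

text \<open>The sizes of the supports multiply to the size of the full space because the weights add
  up to \<open>n\<close>. The sum lies in that space, so directness means that it fills it.\<close>

lemma is_direct_sum_supp_iff: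
  assumes C: "is_code n k C" and cs: "length cs = k" "code_basis n C cs"
    and n: "n = (\<Sum>i<k. rank_weight \<iota> (cs ! i))"
  shows "is_direct_sum n (supp_code \<iota> \<Gamma> n C) (map supp cs) \<longleftrightarrow> nondegenerate \<iota> \<Gamma> n C"
proof -
  have csn: "set cs \<subseteq> carrier_vec n" and G: "generator_matrix k n (mat_of_rows n cs) C"
    using code_basis_iff_generator_matrix[OF C cs(1)] cs(2) by auto
  have S: "supp_code \<iota> \<Gamma> n C = subspace_sum n (map supp cs)"
    using supp_code_eq[OF C G] subspace_sum_supp[OF csn] cs(1) by simp
  have sub: "supp_code \<iota> \<Gamma> n C \<subseteq> carrier_vec n"
    unfolding supp_code_eq[OF C G] by (auto simp: support_sum_def)
  have "is_direct_sum n (supp_code \<iota> \<Gamma> n C) (map supp cs) \<longleftrightarrow>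
      card (supp_code \<iota> \<Gamma> n C) = (\<Prod>i<k. card (supp (cs ! i)))"
    unfolding S using is_direct_sum_iff_card[of "map supp cs" n] is_subspace_supp csn cs(1)
    by (auto simp: subset_iff)
  also have "(\<Prod>i<k. card (supp (cs ! i))) = card (carrier_vec n :: 'f vec set)"
    by (simp add: card_supp card_carrier_vec n flip: power_sum)
  also have "card (supp_code \<iota> \<Gamma> n C) = card (carrier_vec n :: 'f vec set) \<longleftrightarrow> nondegenerate \<iota> \<Gamma> n C"
    unfolding nondegenerate_def using card_subset_eq[OF finite_carrier_vec sub] by auto
  finally show ?thesis .
qed

text \<open>The same basis serves both sides: the dimensions of its supports are its weights, and
  once these add up to \<open>n\<close>, directness is nondegeneracy.\<close>

lemma has_basis_splitting_support_iff:
  assumes C: "is_code n k C" and len: "length ns = k"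
  shows "has_basis_splitting_support \<iota> \<Gamma> n k ns C \<longleftrightarrow>
    nondegenerate \<iota> \<Gamma> n C \<and> has_basis_of_weights \<iota> n k ns C"
proof -
  have "n = sum_list ns \<and> is_direct_sum n (supp_code \<iota> \<Gamma> n C) (map supp cs) \<and>
        (\<forall>i<k. subspace_dim n (supp (cs ! i)) = ns ! i) \<longleftrightarrow>
      nondegenerate \<iota> \<Gamma> n C \<and> n = sum_list ns \<and> (\<forall>i<k. ns ! i = rank_weight \<iota> (cs ! i))"
    if cs: "length cs = k" "code_basis n C cs" for cs
  proof -
    have csn: "set cs \<subseteq> carrier_vec n"
      using code_basis_iff_generator_matrix[OF C cs(1)] cs(2) by auto
    have dim: "subspace_dim n (supp (cs ! i)) = rank_weight \<iota> (cs ! i)" if "i < k" for i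
      using that csn cs(1) by (intro subspace_dim_supp) auto
    have "n = (\<Sum>i<k. rank_weight \<iota> (cs ! i))"
      if "n = sum_list ns" "\<forall>i<k. ns ! i = rank_weight \<iota> (cs ! i)"
      using that len by (simp add: sum_list_sum_nth lessThan_atLeast0)
    then show ?thesis
      using is_direct_sum_supp_iff[OF C cs] dim by metis
  qed
  then show ?thesis
    unfolding has_basis_splitting_support_def has_basis_of_weights_def by blast
qed

text \<open>Undoing the equivalence turns the block-diagonal matrix into a generator of
  \<open>C\<close> itself. An invertible matrix over the small field preserves the weights of the
  rows and carries the full support onto the full space.\<close>

lemma block_diag_imp_nondegenerate_weights:
  assumes C: "is_code n k C" and len: "length ns = k"
    and block: "has_block_diag_generator \<iota> n k ns C"
  shows "nondegenerate \<iota> \<Gamma> n C \<and> has_basis_of_weights \<iota> n k ns C"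
proof -
  obtain C' us where equiv: "code_equiv \<iota> n C C'" and us: "list_all2 full_rank_row us ns"
    and gen: "generator_matrix k n (diag_block_mat us) C'"
    using block unfolding has_block_diag_generator_iff[OF len] by blast
  define G where "G = diag_block_mat us"
  have G: "G \<in> carrier_mat k n"
    using gen by (simp add: generator_matrix_def G_def)
  have n: "n = sum_list ns"
    using carrier_matD(2)[OF diag_block_mat_carrier[OF us]] carrier_matD(2)[OF G] by (simp add: G_def)
  obtain A where A: "A \<in> carrier_mat n n" and inv: "invertible_mat A"
    and C': "C' = {vec_mat_mult c (map_mat \<iota> A) | c. c \<in> C}" and Cn: "C \<subseteq> carrier_vec n"
    using equiv by (auto simp: code_equiv_def)
  obtain B where B: "B \<in> carrier_mat n n" and AB: "A * B = 1\<^sub>m n" and BA: "B * A = 1\<^sub>m n"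
    by (rule invertible_matE[OF inv A])
  have cancel: "vec_mat_mult (vec_mat_mult c (map_mat \<iota> A)) (map_mat \<iota> B) = c"
    if "c \<in> carrier_vec n" for c
    using that A B by (simp add: vec_mat_mult_assoc[of _ n n _ n] map_mat_hom_inverse[OF A B AB] vec_mat_mult_one)
  have "{vec_mat_mult c (map_mat \<iota> B) | c. c \<in> C'} =
      (\<lambda>c. vec_mat_mult (vec_mat_mult c (map_mat \<iota> A)) (map_mat \<iota> B)) ` C"
    unfolding C' by blast
  also have "\<dots> = (\<lambda>c. c) ` C"
    using Cn by (intro image_cong refl cancel) blast
  finally have genC: "generator_matrix k n (G * map_mat \<iota> B) C"
    using generator_matrix_mult[OF gen, of "map_mat \<iota> B" n] B by (simp add: G_def)
  define cs where "cs = rows (G * map_mat \<iota> B)"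
  have GB: "G * map_mat \<iota> B \<in> carrier_mat k n"
    using G B by auto
  have cs: "length cs = k" "set cs \<subseteq> carrier_vec n" "mat_of_rows n cs = G * map_mat \<iota> B"
    using carrier_matD[OF GB] rows_carrier[of "G * map_mat \<iota> B"] mat_of_rows_rows[of "G * map_mat \<iota> B"]
    by (simp_all only: cs_def length_rows)
  then have cb: "code_basis n C cs"
    using code_basis_iff_generator_matrix[OF C cs(1)] genC by simp
  have "ns ! i = rank_weight \<iota> (cs ! i)" if i: "i < k" for i
  proof -
    have "cs ! i = vec_mat_mult (row G i) (map_mat \<iota> B)"
      using i G B row_mult_mat[of G k n "map_mat \<iota> B" n i] by (simp add: cs_def del: row_mult)
    then have "rank_weight \<iota> (cs ! i) = rank_weight \<iota> (row G i)"
      using rank_weight_mult_invertible[OF B A BA row_carrier_vec[OF i G]] by simp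
    then show ?thesis
      using rank_weight_row_diag_block[OF us] i len by (simp add: G_def)
  qed
  then have "has_basis_of_weights \<iota> n k ns C"
    using cs cb n by (auto simp: has_basis_of_weights_def)
  moreover have "support_sum k n (G * map_mat \<iota> B) = carrier_vec n"
  proof -
    have full: "support_sum k n G = carrier_vec n"
      using support_sum_diag_block[OF us] len n by (simp add: G_def)
    \<comment> \<open>Right multiplication by \<open>B\<close> is onto, with \<open>A\<close>
      producing the preimage.\<close>
    have "y \<in> (\<lambda>y. vec_mat_mult y B) ` carrier_vec n" if y: "y \<in> carrier_vec n" for y
      using y A B AB BA vec_mat_mult_assoc[OF A B y] vec_mat_mult_assoc[OF B A y] vec_mat_mult_one[OF y]
      by (intro image_eqI[of _ _ "vec_mat_mult y A"]) auto
    then show ?thesis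
      unfolding support_sum_mult_right[OF G B] full using B by auto
  qed
  ultimately show ?thesis
    using nondegenerate_iff[OF C genC] by simp
qed

text \<open>The basis factors as a block-diagonal matrix times a matrix \<open>A\<close> over the
  small field. Nondegeneracy makes \<open>A\<close> invertible, and its inverse is the required
  equivalence.\<close>

lemma nondegenerate_weights_imp_block_diag:
  assumes C: "is_code n k C" and len: "length ns = k"
    and nd: "nondegenerate \<iota> \<Gamma> n C" and weights: "has_basis_of_weights \<iota> n k ns C"
  shows "has_block_diag_generator \<iota> n k ns C"
proof -
  obtain cs where cs: "length cs = k" "code_basis n C cs" and n: "n = sum_list ns"
    and w: "\<And>i. i < k \<Longrightarrow> ns ! i = rank_weight \<iota> (cs ! i)"
    using weights by (auto simp: has_basis_of_weights_def)
  have csn: "set cs \<subseteq> carrier_vec n" and gen: "generator_matrix k n (mat_of_rows n cs) C"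
    using code_basis_iff_generator_matrix[OF C cs(1)] cs(2) by auto
  have ns: "map (rank_weight \<iota>) cs = ns"
    using w cs(1) len by (intro nth_equalityI) simp_all
  \<comment> \<open>The number of rows of the stacked factor is the sum of the weights, which is
    \<open>n\<close>, so \<open>A\<close> is square.\<close>
  obtain us A where us: "list_all2 full_rank_row us ns" and A: "A \<in> carrier_mat n n"
    and eq: "mat_of_rows n cs = diag_block_mat us * map_mat \<iota> A"
    using mat_of_rows_factor[OF csn] unfolding ns n[symmetric] by blast
  define G where "G = diag_block_mat us"
  have G: "G \<in> carrier_mat k n"
    using diag_block_mat_carrier[OF us] len n by (simp add: G_def)
  have genC: "generator_matrix k n (G * map_mat \<iota> A) C"
    using gen eq by (simp add: G_def)
  have "support_sum k n (G * map_mat \<iota> A) = carrier_vec n"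
    using nd nondegenerate_iff[OF C genC] by simp
  \<comment> \<open>The support of the code is contained in the image of \<open>A\<close>, so a full
    support makes right multiplication by \<open>A\<close> onto.\<close>
  then have "\<exists>x\<in>carrier_vec n. y = vec_mat_mult x A" if "y \<in> carrier_vec n" for y
    using that unfolding support_sum_mult_right[OF G A] by (auto simp: support_sum_def)
  then obtain B where B: "B \<in> carrier_mat n n" and AB: "A * B = 1\<^sub>m n" and BA: "B * A = 1\<^sub>m n"
    using invertible_mat_if_surj[OF A] by blast
  have "G * map_mat \<iota> A * map_mat \<iota> B = G * (map_mat \<iota> A * map_mat \<iota> B)"
    using G A B by (intro assoc_mult_mat) auto
  then have GAB: "G * map_mat \<iota> A * map_mat \<iota> B = G"
    using map_mat_hom_inverse[OF A B AB] G by simp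
  define C' where "C' = {vec_mat_mult c (map_mat \<iota> B) | c. c \<in> C}"
  have gen': "generator_matrix k n G C'"
    using generator_matrix_mult[OF genC, of "map_mat \<iota> B" n] B unfolding GAB C'_def by simp
  have "C \<subseteq> carrier_vec n" "C' \<subseteq> carrier_vec n"
    using subspace_carrier[OF is_subspace_of_generator_matrix[OF genC]]
      subspace_carrier[OF is_subspace_of_generator_matrix[OF gen']] by auto
  then have "code_equiv \<iota> n C C'"
    unfolding code_equiv_def using B invertible_matI[OF B A BA AB] C'_def by blast
  then show ?thesis
    unfolding has_block_diag_generator_iff[OF len] using us gen' G_def by blast
qed

end

text \<open>Weights alone do not prevent the supports of basis vectors from overlapping, so the way
  back from \<open>has_basis_of_weights\<close> is stated under \<open>nondegenerate\<close>; the
  other three conditions are equivalent outright.\<close>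

theorem theorem3p2:
  fixes \<iota> :: "'f::{field,finite} \<Rightarrow> 'e::{field,finite}"
    and q m n k :: nat
    and ns :: "nat list"
    and \<Gamma> :: "'e list"
    and C :: "'e vec set"
  assumes "field_hom \<iota>"
    and "CARD('f) = q" and "CARD('e) = q ^ m"
    and "ordered_basis \<iota> m \<Gamma>"
    and "is_code n k C"
    and "k \<ge> 1" and "length ns = k"
    and "m > hd ns" and "sorted_wrt (\<ge>) ns" and "last ns \<ge> 1"
  shows "(equivalent_to_sum_of_mrd \<iota> m n k ns C \<longleftrightarrow> has_basis_splitting_support \<iota> \<Gamma> n k ns C) \<and>
    (equivalent_to_sum_of_mrd \<iota> m n k ns C \<longleftrightarrow> has_block_diag_generator \<iota> n k ns C) \<and>
    (equivalent_to_sum_of_mrd \<iota> m n k ns C \<longrightarrow> has_basis_of_weights \<iota> n k ns C) \<and>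
    (nondegenerate \<iota> \<Gamma> n C \<longrightarrow>
       (has_basis_of_weights \<iota> n k ns C \<longrightarrow> equivalent_to_sum_of_mrd \<iota> m n k ns C))"
proof -
  interpret finite_field_extension \<iota> m \<Gamma>
    using assms(1,4)
    by (simp add: finite_field_extension_def field_extension_def finite_field_extension_axioms_def)
  note C = assms(5) and len = assms(7)
  \<comment> \<open>The list is nonincreasing, so its head bounds every entry from above and its
    last element bounds every entry from below.\<close>
  have bounds: "1 \<le> ns ! i \<and> ns ! i < m" if i: "i < k" for i
  proof -
    have "ns ! i \<le> ns ! 0"
      using sorted_wrt_nth_less[OF assms(9), of 0 i] i len by (cases "i = 0") auto
    moreover have "ns ! (k - 1) \<le> ns ! i"
      using sorted_wrt_nth_less[OF assms(9), of i "k - 1"] i len by (cases "i = k - 1") auto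
    moreover have "ns \<noteq> []"
      using len assms(6) by auto
    ultimately show ?thesis
      using assms(6,8,10) len by (simp add: hd_conv_nth last_conv_nth)
  qed
  have "equivalent_to_sum_of_mrd \<iota> m n k ns C \<longleftrightarrow> has_block_diag_generator \<iota> n k ns C"
    by (rule equivalent_to_sum_of_mrd_iff_block_diag[OF len bounds])
  moreover have "has_block_diag_generator \<iota> n k ns C \<longleftrightarrow>
      nondegenerate \<iota> \<Gamma> n C \<and> has_basis_of_weights \<iota> n k ns C"
    using block_diag_imp_nondegenerate_weights[OF C len] nondegenerate_weights_imp_block_diag[OF C len]
    by blast
  ultimately show ?thesis
    using has_basis_splitting_support_iff[OF C len] by blast
qed

end
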